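(* Let $G$ be a Coxeter group or a graph product of groups. Then the intersection of any two parabolic subgroups of $G$ is a parabolic subgroup of $G$.
   Context: Coxeter group: given a set $S$ and a Coxeter matrix $M=\{m_{r,s}\}_{r,s\in S}$ (symmetric, entries in $\mathbb{N}\cup\{\infty\}$, $m_{s,s}=1$, $m_{r,s}\ge2$ for $r\neq s$), $W=\langle s\in S\mid (rs)^{m_{r,s}}=1 \text{ for all } r,s\in S\rangle$ (no relation when $m_{r,s}=\infty$). For $I\subset S$, $W_I$ is the subgroup generated by $I$. A parabolic subgroup of $W$ is a subgroup of the form $wW_Iw^{-1}$ with $w\in W$, $I\subset S$. Graph product: given a simplicial graph $\mathcal{G}$ (no loops, no multiple edges) with vertex set $S$ and a group $G_s$ for each $s\in S$, the graph product $\Gamma$ given by $(\mathcal{G},\{G_s\}_{s\in S})$ is the quotient of the free product of the groups $G_s$ by the normal subgroup generated by all commutators $gg'g^{-1}g'^{-1}$ with $g\in G_s$, $g'\in G_{s'}$ and $s,s'$ joined by an edge. For $I\subset S$, $\Gamma_I=\langle G_s : s\in I\rangle$. A parabolic subgroup of $\Gamma$ is a subgroup of the form $g\Gamma_Ig^{-1}$ with $g\in\Gamma$, $I\subset S$. Parabolic subgroups are understood with respect to the fixed Coxeter generating set $S$ (resp. the fixed graph product decomposition). *)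

theory Defs
  imports "HOL-Algebra.Generated_Groups" "HOL-Library.Extended_Nat"
begin

section \<open>Words modulo relations\<close>

text \<open>
  The monoid presented by an alphabet \<open>X\<close> and a set \<open>R\<close> of pairs of words: words over \<open>X\<close> modulo
  the congruence generated by \<open>R\<close>. It is only used with relations that make it a group.
\<close>

inductive_set word_cong :: "'x set \<Rightarrow> ('x list \<times> 'x list) set \<Rightarrow> ('x list \<times> 'x list) set"
  for X :: "'x set" and R :: "('x list \<times> 'x list) set" where
  rel: "\<lbrakk>(l, r) \<in> R; u @ l @ v \<in> lists X; u @ r @ v \<in> lists X\<rbrakk>
          \<Longrightarrow> (u @ l @ v, u @ r @ v) \<in> word_cong X R"
| refl: "u \<in> lists X \<Longrightarrow> (u, u) \<in> word_cong X R"
| sym: "(u, v) \<in> word_cong X R \<Longrightarrow> (v, u) \<in> word_cong X R"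
| trans: "\<lbrakk>(u, v) \<in> word_cong X R; (v, w) \<in> word_cong X R\<rbrakk> \<Longrightarrow> (u, w) \<in> word_cong X R"

definition word_quotient :: "'x set \<Rightarrow> ('x list \<times> 'x list) set \<Rightarrow> 'x list set monoid" where
  "word_quotient X R =
     \<lparr>carrier = lists X // word_cong X R,
      mult = (\<lambda>A B. \<Union>u\<in>A. \<Union>v\<in>B. word_cong X R `` {u @ v}),
      one = word_cong X R `` {[]}\<rparr>"

lemma equiv_word_cong: "equiv (lists X) (word_cong X R)"
proof (rule equivI)
  show "word_cong X R \<subseteq> lists X \<times> lists X"
  proof (rule subrelI)
    fix u v assume "(u, v) \<in> word_cong X R"
    then show "(u, v) \<in> lists X \<times> lists X" by induction auto
  qed
  show "refl_on (lists X) (word_cong X R)"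
    by (auto intro: refl_onI word_cong.refl)
  show "sym (word_cong X R)" by (auto intro: symI word_cong.sym)
  show "trans (word_cong X R)" by (auto intro: transI word_cong.trans)
qed

lemma word_cong_in_lists:
  "(u, v) \<in> word_cong X R \<Longrightarrow> u \<in> lists X" "(u, v) \<in> word_cong X R \<Longrightarrow> v \<in> lists X"
  using equiv_word_cong[of X R] by (auto simp: equiv_def)

lemma word_cong_context:
  assumes "(u, v) \<in> word_cong X R" "a \<in> lists X" "b \<in> lists X"
  shows "(a @ u @ b, a @ v @ b) \<in> word_cong X R"
  using assms
proof induction
  case (rel l r u v)
  then show ?case using word_cong.rel[of l r R "a @ u" "v @ b" X] by simp
next
  case (refl u)
  then show ?case by (intro word_cong.refl) auto
next
  case (sym u v)
  then show ?case by (auto intro: word_cong.sym)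
next
  case (trans u v w)
  then show ?case by (blast intro: word_cong.trans)
qed

lemma word_cong_append:
  assumes "(u, u') \<in> word_cong X R" "(v, v') \<in> word_cong X R"
  shows "(u @ v, u' @ v') \<in> word_cong X R"
proof -
  have "(u @ v, u' @ v) \<in> word_cong X R"
    using word_cong_context[OF assms(1), of "[]" v] word_cong_in_lists[OF assms(2)] by simp
  moreover have "(u' @ v, u' @ v') \<in> word_cong X R"
    using word_cong_context[OF assms(2), of u' "[]"] word_cong_in_lists[OF assms(1)] by simp
  ultimately show ?thesis by (rule word_cong.trans)
qed

lemma word_quotient_mult:
  assumes "u \<in> lists X" "v \<in> lists X"
  shows "word_cong X R `` {u} \<otimes>\<^bsub>word_quotient X R\<^esub> word_cong X R `` {v}
       = word_cong X R `` {u @ v}"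
proof -
  have "congruent2 (word_cong X R) (word_cong X R) (\<lambda>u v. word_cong X R `` {u @ v})"
    by (auto simp: congruent2_def intro!: equiv_class_eq[OF equiv_word_cong] word_cong_append)
  from UN_equiv_class2[OF equiv_word_cong equiv_word_cong this assms]
  show ?thesis by (simp add: word_quotient_def)
qed

lemma group_word_quotient:
  assumes inv: "\<And>x. x \<in> X \<Longrightarrow> \<exists>y\<in>X. ([y, x], []) \<in> word_cong X R"
  shows "group (word_quotient X R)"
proof (rule groupI)
  have car: "carrier (word_quotient X R) = lists X // word_cong X R"
    by (simp add: word_quotient_def)
  have one: "\<one>\<^bsub>word_quotient X R\<^esub> = word_cong X R `` {[]}"
    by (simp add: word_quotient_def)
  show "x \<otimes>\<^bsub>word_quotient X R\<^esub> y \<in> carrier (word_quotient X R)"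
    if "x \<in> carrier (word_quotient X R)" "y \<in> carrier (word_quotient X R)" for x y
    using that unfolding car
    by (elim quotientE) (auto simp: word_quotient_mult intro!: quotientI)
  show "\<one>\<^bsub>word_quotient X R\<^esub> \<in> carrier (word_quotient X R)"
    unfolding car one by (auto intro!: quotientI)
  show "x \<otimes>\<^bsub>word_quotient X R\<^esub> y \<otimes>\<^bsub>word_quotient X R\<^esub> z
      = x \<otimes>\<^bsub>word_quotient X R\<^esub> (y \<otimes>\<^bsub>word_quotient X R\<^esub> z)"
    if "x \<in> carrier (word_quotient X R)" "y \<in> carrier (word_quotient X R)"
      "z \<in> carrier (word_quotient X R)" for x y z
    using that unfolding car
    by (elim quotientE) (simp add: word_quotient_mult)
  show "\<one>\<^bsub>word_quotient X R\<^esub> \<otimes>\<^bsub>word_quotient X R\<^esub> x = x"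
    if "x \<in> carrier (word_quotient X R)" for x
    using that unfolding car one
    by (elim quotientE) (simp add: word_quotient_mult)
  have "\<exists>v\<in>lists X. (v @ u, []) \<in> word_cong X R" if "u \<in> lists X" for u
    using that
  proof (induction u)
    case Nil
    then show ?case by (auto intro!: bexI[of _ "[]"] word_cong.refl)
  next
    case (Cons x u)
    then obtain v y where v: "v \<in> lists X" "(v @ u, []) \<in> word_cong X R"
      and y: "y \<in> X" "([y, x], []) \<in> word_cong X R"
      using inv by blast
    have "(v @ [y, x] @ u, v @ [] @ u) \<in> word_cong X R"
      using word_cong_context[OF y(2)] v(1) Cons by blast
    then have "((v @ [y]) @ x # u, []) \<in> word_cong X R"
      using v(2) by (auto intro: word_cong.trans)
    then show ?case using v(1) y(1) by (intro bexI[of _ "v @ [y]"]) auto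
  qed
  then show "\<exists>y\<in>carrier (word_quotient X R). y \<otimes>\<^bsub>word_quotient X R\<^esub> x = \<one>\<^bsub>word_quotient X R\<^esub>"
    if "x \<in> carrier (word_quotient X R)" for x
    using that unfolding car one
    by (elim quotientE)
      (metis word_quotient_mult equiv_class_eq[OF equiv_word_cong] quotientI)
qed

section \<open>Free groups, free products and normal closures\<close>

text \<open>In the free group on \<open>S\<close>, the letter \<open>(s, True)\<close> is \<open>s\<close> and \<open>(s, False)\<close> is its inverse.\<close>

definition free_group_rels :: "'a set \<Rightarrow> (('a \<times> bool) list \<times> ('a \<times> bool) list) set" where
  "free_group_rels S = {([(s, b), (s, \<not> b)], []) | s b. s \<in> S}"

definition free_group :: "'a set \<Rightarrow> ('a \<times> bool) list set monoid" where
  "free_group S = word_quotient (S \<times> UNIV) (free_group_rels S)"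

definition free_group_gen :: "'a set \<Rightarrow> 'a \<Rightarrow> ('a \<times> bool) list set" where
  "free_group_gen S s = word_cong (S \<times> UNIV) (free_group_rels S) `` {[(s, True)]}"

text \<open>The free product of the groups \<open>G s\<close>, where \<open>s\<close> ranges over \<open>S\<close>.\<close>

definition free_product_rels ::
  "'a set \<Rightarrow> ('a \<Rightarrow> ('b, 'm) monoid_scheme) \<Rightarrow> (('a \<times> 'b) list \<times> ('a \<times> 'b) list) set" where
  "free_product_rels S G =
     {([(s, \<one>\<^bsub>G s\<^esub>)], []) | s. s \<in> S} \<union>
     {([(s, g), (s, h)], [(s, g \<otimes>\<^bsub>G s\<^esub> h)]) | s g h.
        s \<in> S \<and> g \<in> carrier (G s) \<and> h \<in> carrier (G s)}"

definition free_product ::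
  "'a set \<Rightarrow> ('a \<Rightarrow> ('b, 'm) monoid_scheme) \<Rightarrow> ('a \<times> 'b) list set monoid" where
  "free_product S G = word_quotient (SIGMA s:S. carrier (G s)) (free_product_rels S G)"

definition free_product_inj ::
  "'a set \<Rightarrow> ('a \<Rightarrow> ('b, 'm) monoid_scheme) \<Rightarrow> 'a \<Rightarrow> 'b \<Rightarrow> ('a \<times> 'b) list set" where
  "free_product_inj S G s g =
     word_cong (SIGMA s:S. carrier (G s)) (free_product_rels S G) `` {[(s, g)]}"

lemma group_free_group: "group (free_group S)"
  unfolding free_group_def
proof (rule group_word_quotient)
  fix x :: "'a \<times> bool" assume x: "x \<in> S \<times> UNIV"
  obtain s b where sb: "x = (s, b)" "s \<in> S" using x by auto
  have "([(s, \<not> b), (s, \<not> \<not> b)], []) \<in> free_group_rels S"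
    unfolding free_group_rels_def using sb by blast
  then have "([(s, \<not> b), (s, b)], []) \<in> word_cong (S \<times> UNIV) (free_group_rels S)"
    using word_cong.rel[of "[(s, \<not> b), (s, b)]" "[]" "free_group_rels S" "[]" "[]" "S \<times> UNIV"] sb
    by simp
  then show "\<exists>y\<in>S \<times> UNIV. ([y, x], []) \<in> word_cong (S \<times> UNIV) (free_group_rels S)"
    using sb by blast
qed

lemma group_free_product:
  assumes "\<And>s. s \<in> S \<Longrightarrow> group (G s)"
  shows "group (free_product S G)"
  unfolding free_product_def
proof (rule group_word_quotient)
  let ?X = "SIGMA s:S. carrier (G s)" and ?R = "free_product_rels S G"
  fix x assume "x \<in> ?X"
  then obtain s g where sg: "x = (s, g)" "s \<in> S" "g \<in> carrier (G s)" by auto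
  interpret group "G s" using assms sg(2) .
  let ?h = "inv\<^bsub>G s\<^esub> g"
  have "([(s, ?h), (s, g)], [(s, \<one>\<^bsub>G s\<^esub>)]) \<in> ?R"
    unfolding free_product_rels_def using sg l_inv[OF sg(3)] inv_closed[OF sg(3)] by force
  then have 1: "([(s, ?h), (s, g)], [(s, \<one>\<^bsub>G s\<^esub>)]) \<in> word_cong ?X ?R"
    using word_cong.rel[of _ _ ?R "[]" "[]" ?X] sg by fastforce
  have "([(s, \<one>\<^bsub>G s\<^esub>)], []) \<in> ?R"
    unfolding free_product_rels_def using sg by blast
  then have "([(s, \<one>\<^bsub>G s\<^esub>)], []) \<in> word_cong ?X ?R"
    using word_cong.rel[of _ _ ?R "[]" "[]" ?X] sg by fastforce
  with 1 have "([(s, ?h), (s, g)], []) \<in> word_cong ?X ?R" by (rule word_cong.trans)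
  then show "\<exists>y\<in>?X. ([y, x], []) \<in> word_cong ?X ?R"
    using sg by (intro bexI[of _ "(s, ?h)"]) auto
qed

definition normal_closure :: "('g, 'm) monoid_scheme \<Rightarrow> 'g set \<Rightarrow> 'g set" where
  "normal_closure G A = \<Inter>{N. N \<lhd> G \<and> A \<subseteq> N}"

lemma (in group) normal_normal_closure:
  assumes "A \<subseteq> carrier G"
  shows "normal_closure G A \<lhd> G"
proof -
  have car: "carrier G \<in> {N. N \<lhd> G \<and> A \<subseteq> N}"
    using assms by (auto simp: normal_inv_iff subgroup_self)
  have "subgroup (normal_closure G A) G"
    unfolding normal_closure_def
    using car by (intro subgroups_Inter) (auto simp: normal_inv_iff)
  then show ?thesis
    by (auto simp: normal_inv_iff normal_closure_def)
qed

section \<open>Coxeter groups\<close>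

definition coxeter_matrix :: "'a set \<Rightarrow> ('a \<Rightarrow> 'a \<Rightarrow> enat) \<Rightarrow> bool" where
  "coxeter_matrix S M \<longleftrightarrow>
     (\<forall>r\<in>S. \<forall>s\<in>S. M r s = M s r) \<and>
     (\<forall>s\<in>S. M s s = 1) \<and>
     (\<forall>r\<in>S. \<forall>s\<in>S. r \<noteq> s \<longrightarrow> 2 \<le> M r s)"

definition coxeter_relators ::
  "'a set \<Rightarrow> ('a \<Rightarrow> 'a \<Rightarrow> enat) \<Rightarrow> ('a \<times> bool) list set set" where
  "coxeter_relators S M =
     {(free_group_gen S r \<otimes>\<^bsub>free_group S\<^esub> free_group_gen S s) [^]\<^bsub>free_group S\<^esub> m | r s m.
        r \<in> S \<and> s \<in> S \<and> M r s = enat m}"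

definition coxeter_kernel ::
  "'a set \<Rightarrow> ('a \<Rightarrow> 'a \<Rightarrow> enat) \<Rightarrow> ('a \<times> bool) list set set" where
  "coxeter_kernel S M = normal_closure (free_group S) (coxeter_relators S M)"

definition coxeter_group ::
  "'a set \<Rightarrow> ('a \<Rightarrow> 'a \<Rightarrow> enat) \<Rightarrow> ('a \<times> bool) list set set monoid" where
  "coxeter_group S M = free_group S Mod coxeter_kernel S M"

definition coxeter_gen ::
  "'a set \<Rightarrow> ('a \<Rightarrow> 'a \<Rightarrow> enat) \<Rightarrow> 'a \<Rightarrow> ('a \<times> bool) list set set" where
  "coxeter_gen S M s = coxeter_kernel S M #>\<^bsub>free_group S\<^esub> free_group_gen S s"

section \<open>Graph products\<close>

text \<open>\<open>E s t\<close> means that \<open>s\<close> and \<open>t\<close> are joined by an edge; values outside \<open>S\<close> are irrelevant.\<close>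

definition simplicial_graph :: "'a set \<Rightarrow> ('a \<Rightarrow> 'a \<Rightarrow> bool) \<Rightarrow> bool" where
  "simplicial_graph S E \<longleftrightarrow> (\<forall>s\<in>S. \<not> E s s) \<and> (\<forall>s\<in>S. \<forall>t\<in>S. E s t \<longrightarrow> E t s)"

definition graph_product_commutators ::
  "'a set \<Rightarrow> ('a \<Rightarrow> 'a \<Rightarrow> bool) \<Rightarrow> ('a \<Rightarrow> ('b, 'm) monoid_scheme) \<Rightarrow> ('a \<times> 'b) list set set" where
  "graph_product_commutators S E G =
     {x \<otimes>\<^bsub>free_product S G\<^esub> y \<otimes>\<^bsub>free_product S G\<^esub>
        inv\<^bsub>free_product S G\<^esub> x \<otimes>\<^bsub>free_product S G\<^esub> inv\<^bsub>free_product S G\<^esub> y | x y s t.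
        s \<in> S \<and> t \<in> S \<and> E s t \<and>
        x \<in> free_product_inj S G s ` carrier (G s) \<and> y \<in> free_product_inj S G t ` carrier (G t)}"

definition graph_product_kernel ::
  "'a set \<Rightarrow> ('a \<Rightarrow> 'a \<Rightarrow> bool) \<Rightarrow> ('a \<Rightarrow> ('b, 'm) monoid_scheme) \<Rightarrow> ('a \<times> 'b) list set set" where
  "graph_product_kernel S E G = normal_closure (free_product S G) (graph_product_commutators S E G)"

definition graph_product ::
  "'a set \<Rightarrow> ('a \<Rightarrow> 'a \<Rightarrow> bool) \<Rightarrow> ('a \<Rightarrow> ('b, 'm) monoid_scheme) \<Rightarrow>
     ('a \<times> 'b) list set set monoid" where
  "graph_product S E G = free_product S G Mod graph_product_kernel S E G"

text \<open>The image of the vertex group \<open>G s\<close> in the graph product.\<close>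

definition vertex_group ::
  "'a set \<Rightarrow> ('a \<Rightarrow> 'a \<Rightarrow> bool) \<Rightarrow> ('a \<Rightarrow> ('b, 'm) monoid_scheme) \<Rightarrow> 'a \<Rightarrow>
     ('a \<times> 'b) list set set set" where
  "vertex_group S E G s =
     (\<lambda>g. graph_product_kernel S E G #>\<^bsub>free_product S G\<^esub> free_product_inj S G s g) ` carrier (G s)"

section \<open>Parabolic subgroups\<close>

text \<open>
  \<open>X s\<close> is the part of the group attached to the index \<open>s\<close>: a single generator for Coxeter groups,
  a vertex group for graph products.
\<close>

definition parabolic_subgroup ::
  "('g, 'm) monoid_scheme \<Rightarrow> 'a set \<Rightarrow> ('a \<Rightarrow> 'g set) \<Rightarrow> 'g set \<Rightarrow> bool" where
  "parabolic_subgroup G S X P \<longleftrightarrow>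
     (\<exists>g\<in>carrier G. \<exists>I\<subseteq>S. P = g <#\<^bsub>G\<^esub> generate G (\<Union>s\<in>I. X s) #>\<^bsub>G\<^esub> inv\<^bsub>G\<^esub> g)"

definition coxeter_parabolic ::
  "'a set \<Rightarrow> ('a \<Rightarrow> 'a \<Rightarrow> enat) \<Rightarrow> ('a \<times> bool) list set set set \<Rightarrow> bool" where
  "coxeter_parabolic S M = parabolic_subgroup (coxeter_group S M) S (\<lambda>s. {coxeter_gen S M s})"

definition graph_product_parabolic ::
  "'a set \<Rightarrow> ('a \<Rightarrow> 'a \<Rightarrow> bool) \<Rightarrow> ('a \<Rightarrow> ('b, 'm) monoid_scheme) \<Rightarrow>
     ('a \<times> 'b) list set set set \<Rightarrow> bool" where
  "graph_product_parabolic S E G =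
     parabolic_subgroup (graph_product S E G) S (vertex_group S E G)"

lemma free_group_gen_closed: "s \<in> S \<Longrightarrow> free_group_gen S s \<in> carrier (free_group S)"
  by (auto simp: free_group_gen_def free_group_def word_quotient_def intro!: quotientI)

lemma free_product_inj_closed:
  "\<lbrakk>s \<in> S; g \<in> carrier (G s)\<rbrakk> \<Longrightarrow> free_product_inj S G s g \<in> carrier (free_product S G)"
  by (auto simp: free_product_inj_def free_product_def word_quotient_def intro!: quotientI)

lemma group_coxeter_group: "group (coxeter_group S M)"
proof -
  interpret group "free_group S" by (rule group_free_group)
  have "coxeter_relators S M \<subseteq> carrier (free_group S)"
    by (auto simp: coxeter_relators_def free_group_gen_closed)
  then show ?thesis
    unfolding coxeter_group_def coxeter_kernel_def
    by (intro normal.factorgroup_is_group normal_normal_closure)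
qed

lemma group_graph_product:
  assumes "\<And>s. s \<in> S \<Longrightarrow> group (G s)"
  shows "group (graph_product S E G)"
proof -
  interpret group "free_product S G" using assms by (rule group_free_product)
  have "graph_product_commutators S E G \<subseteq> carrier (free_product S G)"
    by (auto simp: graph_product_commutators_def free_product_inj_closed)
  then show ?thesis
    unfolding graph_product_def graph_product_kernel_def
    by (intro normal.factorgroup_is_group normal_normal_closure)
qed

end

theory Submission
  imports Defs
begin

text \<open>
  Coxeter groups and graph products are treated at once, as groups \<open>W\<close> generated by a family of
  subgroups \<open>X s\<close>: the subgroups \<open>{\<one>, s}\<close> in the first case, the vertex groups in the second. Write
  \<open>W\<^sub>I\<close> for the subgroup generated by the \<open>X s\<close> with \<open>s \<in> I\<close>.

  The central notion is that of a wall, a conjugate of one of the \<open>X s\<close>. A word \<open>x\<^sub>1 x\<^sub>2 \<dots> x\<^sub>n\<close> with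
  \<open>x\<^sub>i \<in> X s\<^sub>i\<close> crosses the walls \<open>p X s\<^sub>i p\<inverse>\<close>, where \<open>p = x\<^sub>1 \<dots> x\<^sub>i\<^sub>-\<^sub>1\<close>, and at each of them it registers
  the element \<open>p x\<^sub>i p\<inverse>\<close>. In both classes of groups the product of all elements registered at a
  given wall depends only on the value of the word. To see this, the records of words are made the
  second component of a semidirect product \<open>crossing_group W\<close>, and one checks that the records of
  the letters satisfy the defining relations of \<open>W\<close>: \<open>crossing_dihedral_relation\<close> for the relations
  of a Coxeter group, where each wall is crossed an even number of times, and \<open>crossing_mult_same\<close>
  and \<open>crossing_commute\<close> for those of a graph product. Hence a wall at which an element registers
  something nontrivial is crossed by every word for it (\<open>crossed_if_nontrivial\<close>).

  This replaces the exchange condition in the classical description of the intersection of two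
  parabolic subgroups. If \<open>w\<close> is shortest in \<open>W\<^sub>I w\<close>, then \<open>W\<^sub>I \<inter> w W\<^sub>J w\<inverse> = W\<^sub>K\<close>, where \<open>K\<close> consists
  of those \<open>s \<in> I\<close> for which \<open>w\<inverse> X s w \<subseteq> W\<^sub>J\<close> (\<open>std_Int_conj_std\<close>). Indeed, if \<open>u w = w v\<close> with
  \<open>u \<in> W\<^sub>I\<close> and \<open>v \<in> W\<^sub>J\<close>, then the first letter of a shortest word for \<open>u\<close>, taken from \<open>X s\<close> say,
  leaves a trace at the wall \<open>X s\<close> that no later letter of \<open>u w\<close> erases; so the wall is crossed by the
  word for \<open>w v\<close>, and by minimality of \<open>w\<close> this happens within \<open>v\<close>, which shows \<open>s \<in> K\<close>. Conjugation
  reduces the intersection of arbitrary parabolic subgroups to this case.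
\<close>

section \<open>Conjugation\<close>

definition conj_by :: "('g, 'm) monoid_scheme \<Rightarrow> 'g \<Rightarrow> 'g \<Rightarrow> 'g" where
  "conj_by G g x = g \<otimes>\<^bsub>G\<^esub> x \<otimes>\<^bsub>G\<^esub> inv\<^bsub>G\<^esub> g"

context group
begin

lemma conj_by_closed [simp]:
  "\<lbrakk>g \<in> carrier G; x \<in> carrier G\<rbrakk> \<Longrightarrow> conj_by G g x \<in> carrier G"
  by (simp add: conj_by_def)

lemma conj_by_one_left [simp]: "x \<in> carrier G \<Longrightarrow> conj_by G \<one> x = x"
  by (simp add: conj_by_def)

lemma conj_by_one_right [simp]: "g \<in> carrier G \<Longrightarrow> conj_by G g \<one> = \<one>"
  by (simp add: conj_by_def)

lemma conj_by_mult:
  "\<lbrakk>g \<in> carrier G; x \<in> carrier G; y \<in> carrier G\<rbrakk>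
     \<Longrightarrow> conj_by G g (x \<otimes> y) = conj_by G g x \<otimes> conj_by G g y"
  by (simp add: conj_by_def m_assoc inv_solve_left)

lemma conj_by_comp:
  "\<lbrakk>g \<in> carrier G; h \<in> carrier G; x \<in> carrier G\<rbrakk>
     \<Longrightarrow> conj_by G (g \<otimes> h) x = conj_by G g (conj_by G h x)"
  by (simp add: conj_by_def m_assoc inv_mult_group)

lemma conj_by_inv_cancel [simp]:
  assumes "g \<in> carrier G" "x \<in> carrier G"
  shows "conj_by G (inv g) (conj_by G g x) = x" "conj_by G g (conj_by G (inv g) x) = x"
  using assms by (simp_all flip: conj_by_comp)

lemma conj_by_mult_left:
  "\<lbrakk>g \<in> carrier G; x \<in> carrier G\<rbrakk> \<Longrightarrow> conj_by G g x \<otimes> g = g \<otimes> x"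
  by (simp add: conj_by_def m_assoc)

lemma conj_by_image_closed:
  "\<lbrakk>g \<in> carrier G; T \<subseteq> carrier G\<rbrakk> \<Longrightarrow> conj_by G g ` T \<subseteq> carrier G"
  by auto

lemma conj_by_image_one [simp]: "T \<subseteq> carrier G \<Longrightarrow> conj_by G \<one> ` T = T"
  by (force simp: image_iff subset_iff)

lemma conj_by_image_comp:
  assumes "g \<in> carrier G" "h \<in> carrier G" "T \<subseteq> carrier G"
  shows "conj_by G (g \<otimes> h) ` T = conj_by G g ` conj_by G h ` T"
  unfolding image_image using assms by (intro image_cong) (auto simp: conj_by_comp)

lemma conj_by_image_inv_cancel [simp]:
  assumes "g \<in> carrier G" "T \<subseteq> carrier G"
  shows "conj_by G (inv g) ` conj_by G g ` T = T" "conj_by G g ` conj_by G (inv g) ` T = T"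
  using assms by (simp_all flip: conj_by_image_comp)

lemma conj_by_image_eq_iff:
  assumes "g \<in> carrier G" "T \<subseteq> carrier G" "U \<subseteq> carrier G"
  shows "conj_by G (inv g) ` T = U \<longleftrightarrow> T = conj_by G g ` U"
  using assms by auto

lemma conj_by_image_Int:
  assumes "g \<in> carrier G" "T \<subseteq> carrier G" "U \<subseteq> carrier G"
  shows "conj_by G g ` (T \<inter> U) = conj_by G g ` T \<inter> conj_by G g ` U"
proof -
  have "inj_on (conj_by G g) (carrier G)"
    by (rule inj_on_inverseI[of _ "conj_by G (inv g)"]) (simp add: assms(1))
  then show ?thesis using assms by (intro inj_on_image_Int)
qed

lemma conj_by_image_subgroup:
  assumes "subgroup H G" "x \<in> H"
  shows "conj_by G x ` H = H"
proof -
  have sub: "conj_by G y ` H \<subseteq> H" if "y \<in> H" for y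
    using that assms(1)
    by (auto simp: conj_by_def subgroup.m_closed subgroup.m_inv_closed)
  have H: "H \<subseteq> carrier G" by (rule subgroup.subset[OF assms(1)])
  have "H = conj_by G x ` conj_by G (inv x) ` H"
    using conj_by_image_inv_cancel(2)[of x H] H assms(2) by blast
  also have "\<dots> \<subseteq> conj_by G x ` H"
    using sub[OF subgroup.m_inv_closed[OF assms]] by (rule image_mono)
  finally show ?thesis using sub[OF assms(2)] by blast
qed

lemma subgroup_conj_by_image:
  assumes "g \<in> carrier G" "subgroup H G"
  shows "subgroup (conj_by G g ` H) G"
proof -
  have "group_hom G G (conj_by G g)"
    using assms(1) by unfold_locales (auto simp: hom_def conj_by_mult)
  then show ?thesis by (rule group_hom.subgroup_img_is_subgroup) (rule assms(2))
qed

lemma coset_conj_eq: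
  "g <# T #> inv g = conj_by G g ` T"
  by (auto simp: l_coset_def r_coset_def conj_by_def)

end

section \<open>Recording the walls that a word crosses\<close>

text \<open>
  Read a word as a path of prefixes that starts at the identity. A letter \<open>x \<in> X s\<close> read at the
  prefix \<open>p\<close> moves inside the coset \<open>p X s\<close>; the subgroup \<open>p X s p\<inverse>\<close> serves as the name of that
  coset, so that cosets that should be parallel to each other share a name. These subgroups are
  called walls. A pair \<open>(g, f)\<close> stands for a path that ends in \<open>g\<close> and for which \<open>f T\<close> is the product
  of the elements \<open>p x p\<inverse>\<close> over all letters that cross the wall \<open>T\<close>, later letters standing to
  the left: two consecutive letters \<open>x, y \<in> X s\<close> then contribute
  \<open>(p x) y (p x)\<inverse> \<cdot> p x p\<inverse> = p (x y) p\<inverse>\<close>, the same as the single letter \<open>x y\<close>.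
  Appending a path to another one conjugates its record by the end of the first one. This
  makes the set of pairs a semidirect product of \<open>G\<close> with the functions into the opposite group of
  \<open>G\<close>. All subsets of the carrier are allowed as indices because they form a set on which \<open>G\<close> acts
  by conjugation, and the records are extensional functions so that equality of pairs is meaningful.
\<close>

definition crossing_group :: "('g, 'm) monoid_scheme \<Rightarrow> ('g \<times> ('g set \<Rightarrow> 'g)) monoid" where
  "crossing_group G =
     \<lparr>carrier = carrier G \<times> (Pow (carrier G) \<rightarrow>\<^sub>E carrier G),
      mult = (\<lambda>(g, f) (h, k).
        (g \<otimes>\<^bsub>G\<^esub> h, \<lambda>T\<in>Pow (carrier G). conj_by G g (k (conj_by G (inv\<^bsub>G\<^esub> g) ` T)) \<otimes>\<^bsub>G\<^esub> f T)),
      one = (\<one>\<^bsub>G\<^esub>, \<lambda>T\<in>Pow (carrier G). \<one>\<^bsub>G\<^esub>)\<rparr>"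

text \<open>
  The record of a path that consists of the single letter \<open>x\<close>, taken from the subgroup \<open>X\<close>.
\<close>

definition crossing :: "('g, 'm) monoid_scheme \<Rightarrow> 'g set \<Rightarrow> 'g \<Rightarrow> 'g \<times> ('g set \<Rightarrow> 'g)" where
  "crossing G X x = (x, \<lambda>T\<in>Pow (carrier G). if T = X then x else \<one>\<^bsub>G\<^esub>)"

context group
begin

lemma crossing_mult:
  "(g, f) \<otimes>\<^bsub>crossing_group G\<^esub> (h, k) =
     (g \<otimes> h, \<lambda>T\<in>Pow (carrier G). conj_by G g (k (conj_by G (inv g) ` T)) \<otimes> f T)"
  by (simp add: crossing_group_def)

lemma crossing_one: "\<one>\<^bsub>crossing_group G\<^esub> = (\<one>, \<lambda>T\<in>Pow (carrier G). \<one>)"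
  by (simp add: crossing_group_def)

lemma crossing_carrier:
  "carrier (crossing_group G) = carrier G \<times> (Pow (carrier G) \<rightarrow>\<^sub>E carrier G)"
  by (simp add: crossing_group_def)

lemma crossing_closed: "x \<in> carrier G \<Longrightarrow> crossing G X x \<in> carrier (crossing_group G)"
  by (auto simp: crossing_def crossing_carrier)

lemma crossing_of_one: "crossing G X \<one> = \<one>\<^bsub>crossing_group G\<^esub>"
  by (simp add: crossing_def crossing_one cong: if_cong)

lemma group_crossing_group: "group (crossing_group G)"
proof (rule groupI)
  fix a b c assume a: "a \<in> carrier (crossing_group G)" and b: "b \<in> carrier (crossing_group G)"
    and c: "c \<in> carrier (crossing_group G)"
  obtain g f where gf: "a = (g, f)" "g \<in> carrier G" "f \<in> Pow (carrier G) \<rightarrow>\<^sub>E carrier G"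
    using a by (auto simp: crossing_carrier)
  obtain h k where hk: "b = (h, k)" "h \<in> carrier G" "k \<in> Pow (carrier G) \<rightarrow>\<^sub>E carrier G"
    using b by (auto simp: crossing_carrier)
  obtain l m where lm: "c = (l, m)" "l \<in> carrier G" "m \<in> Pow (carrier G) \<rightarrow>\<^sub>E carrier G"
    using c by (auto simp: crossing_carrier)
  have f: "f T \<in> carrier G" and k: "k T \<in> carrier G" and m: "m T \<in> carrier G"
    if "T \<subseteq> carrier G" for T
    using gf(3) hk(3) lm(3) that by auto
  show "a \<otimes>\<^bsub>crossing_group G\<^esub> b \<in> carrier (crossing_group G)"
    using gf hk f k conj_by_image_closed[of "inv g"] by (auto simp: crossing_mult crossing_carrier)
  show "a \<otimes>\<^bsub>crossing_group G\<^esub> b \<otimes>\<^bsub>crossing_group G\<^esub> c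
      = a \<otimes>\<^bsub>crossing_group G\<^esub> (b \<otimes>\<^bsub>crossing_group G\<^esub> c)"
    unfolding gf(1) hk(1) lm(1) crossing_mult
    using gf(2) hk(2) lm(2)
    by (intro prod_eqI)
      (simp_all add: fun_eq_iff restrict_def f k m m_assoc inv_mult_group conj_by_image_closed
        conj_by_image_comp conj_by_comp conj_by_mult)
next
  show "\<one>\<^bsub>crossing_group G\<^esub> \<in> carrier (crossing_group G)"
    by (auto simp: crossing_one crossing_carrier)
next
  fix a assume "a \<in> carrier (crossing_group G)"
  then obtain g f where gf: "a = (g, f)" "g \<in> carrier G" "f \<in> Pow (carrier G) \<rightarrow>\<^sub>E carrier G"
    by (auto simp: crossing_carrier)
  have f: "f T \<in> carrier G" if "T \<subseteq> carrier G" for T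
    using gf(3) that by auto
  have f': "f T = undefined" if "\<not> T \<subseteq> carrier G" for T
    using gf(3) that by (auto simp: PiE_def extensional_def)
  show "\<one>\<^bsub>crossing_group G\<^esub> \<otimes>\<^bsub>crossing_group G\<^esub> a = a"
    unfolding crossing_one gf(1) crossing_mult using gf(2)
    by (auto simp: fun_eq_iff restrict_def f f')
  let ?f = "\<lambda>T\<in>Pow (carrier G). conj_by G (inv g) (inv (f (conj_by G g ` T)))"
  have "(inv g, ?f) \<in> carrier (crossing_group G)"
    using gf(2) f conj_by_image_closed[of g] by (auto simp: crossing_carrier)
  moreover have "(inv g, ?f) \<otimes>\<^bsub>crossing_group G\<^esub> a = \<one>\<^bsub>crossing_group G\<^esub>"
    unfolding crossing_one gf(1) crossing_mult using gf(2)
    by (auto simp: fun_eq_iff restrict_def f conj_by_image_closed simp flip: conj_by_mult)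
  ultimately show "\<exists>b\<in>carrier (crossing_group G).
      b \<otimes>\<^bsub>crossing_group G\<^esub> a = \<one>\<^bsub>crossing_group G\<^esub>" by blast
qed

lemma crossing_group_eqI:
  assumes "p \<in> carrier (crossing_group G)" "q \<in> carrier (crossing_group G)" "fst p = fst q"
    and "\<And>T. T \<subseteq> carrier G \<Longrightarrow> snd p T = snd q T"
  shows "p = q"
proof (rule prod_eqI)
  show "snd p = snd q"
    using assms by (intro PiE_ext[of _ "Pow (carrier G)" "\<lambda>_. carrier G"])
      (auto simp: crossing_carrier)
qed (rule assms(3))

lemma fst_mult_crossing: "fst (p \<otimes>\<^bsub>crossing_group G\<^esub> crossing G X x) = fst p \<otimes> x"
  by (cases p) (simp add: crossing_def crossing_mult)

lemma snd_mult_crossing: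
  assumes "fst p \<in> carrier G" "x \<in> carrier G" "X \<subseteq> carrier G" "T \<subseteq> carrier G"
  shows "snd (p \<otimes>\<^bsub>crossing_group G\<^esub> crossing G X x) T
       = (if T = conj_by G (fst p) ` X then conj_by G (fst p) x else \<one>) \<otimes> snd p T"
proof -
  have "conj_by G (inv (fst p)) ` T \<subseteq> carrier G"
    using assms by (intro conj_by_image_closed) auto
  then show ?thesis
    using assms by (cases p) (simp add: crossing_def crossing_mult conj_by_image_eq_iff)
qed

text \<open>
  A first letter \<open>x \<in> X\<close> fixes its own wall \<open>X\<close> under conjugation, so if the rest of the path does
  not register at \<open>X\<close>, the whole path registers \<open>x\<close> there.
\<close>

lemma snd_crossing_mult:
  assumes "subgroup X G" "x \<in> X" "snd p X = \<one>"
  shows "snd (crossing G X x \<otimes>\<^bsub>crossing_group G\<^esub> p) X = x"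
  using assms subgroup.subset[OF assms(1)]
  by (cases p)
     (auto simp: crossing_def crossing_mult conj_by_image_subgroup subgroup.m_inv_closed subset_iff)

end

section \<open>Words\<close>

definition word_prod :: "('g, 'm) monoid_scheme \<Rightarrow> ('x \<Rightarrow> 'g) \<Rightarrow> 'x list \<Rightarrow> 'g" where
  "word_prod G \<phi> u = foldr (\<lambda>x g. \<phi> x \<otimes>\<^bsub>G\<^esub> g) u \<one>\<^bsub>G\<^esub>"

lemma word_prod_simps [simp]:
  "word_prod G \<phi> [] = \<one>\<^bsub>G\<^esub>" "word_prod G \<phi> (x # u) = \<phi> x \<otimes>\<^bsub>G\<^esub> word_prod G \<phi> u"
  by (simp_all add: word_prod_def)

context group
begin

lemma word_prod_closed: "\<phi> ` set u \<subseteq> carrier G \<Longrightarrow> word_prod G \<phi> u \<in> carrier G"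
  by (induction u) auto

lemma word_prod_append:
  "\<lbrakk>\<phi> ` set u \<subseteq> carrier G; \<phi> ` set v \<subseteq> carrier G\<rbrakk>
     \<Longrightarrow> word_prod G \<phi> (u @ v) = word_prod G \<phi> u \<otimes> word_prod G \<phi> v"
  by (induction u) (auto simp: word_prod_closed m_assoc)

lemma generate_eq_words:
  assumes X: "\<And>s. s \<in> I \<Longrightarrow> subgroup (X s) G"
  shows "generate G (\<Union>s\<in>I. X s) = word_prod G snd ` lists (SIGMA s:I. X s)"
proof
  have car: "snd ` set u \<subseteq> carrier G" if "u \<in> lists (SIGMA s:I. X s)" for u
    using that subgroup.subset[OF X] by fastforce
  show "generate G (\<Union>s\<in>I. X s) \<subseteq> word_prod G snd ` lists (SIGMA s:I. X s)"
  proof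
    have letter: "x \<in> word_prod G snd ` lists (SIGMA s:I. X s)" if "s \<in> I" "x \<in> X s" for s x
      using that subgroup.subset[OF X] by (intro image_eqI[of _ _ "[(s, x)]"]) fastforce+
    fix g assume "g \<in> generate G (\<Union>s\<in>I. X s)"
    then show "g \<in> word_prod G snd ` lists (SIGMA s:I. X s)"
    proof induction
      case one
      then show ?case by (intro image_eqI[of _ _ "[]"]) auto
    next
      case (incl x)
      then show ?case using letter by blast
    next
      case (inv x)
      then show ?case using letter subgroup.m_inv_closed[OF X] by blast
    next
      case (eng x y)
      then obtain u v where "u \<in> lists (SIGMA s:I. X s)" "x = word_prod G snd u"
          "v \<in> lists (SIGMA s:I. X s)" "y = word_prod G snd v"
        by blast
      then show ?case using car by (intro image_eqI[of _ _ "u @ v"]) (auto simp: word_prod_append)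
    qed
  qed
  show "word_prod G snd ` lists (SIGMA s:I. X s) \<subseteq> generate G (\<Union>s\<in>I. X s)"
  proof (rule image_subsetI)
    fix u assume "u \<in> lists (SIGMA s:I. X s)"
    then show "word_prod G snd u \<in> generate G (\<Union>s\<in>I. X s)"
      by (induction u) (auto intro: generate.one intro!: generate.eng[OF generate.incl])
  qed
qed

end

section \<open>Intersections of parabolic subgroups\<close>

lemma append_eq_append_ConsD:
  "a @ b = p @ l # q \<Longrightarrow> (\<exists>q'. a = p @ l # q') \<or> (\<exists>p'. p = a @ p' \<and> b = p' @ l # q)"
  by (auto simp: append_eq_append_conv2 append_eq_Cons_conv)

text \<open>
  The existence of \<open>h\<close> says that what a word registers at each wall depends only on the group
  element that the word represents. Together with the generation by the
  subgroups \<open>X s\<close>, this is all that the intersection theorem rests on; Coxeter groups and graph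
  products both have this property.
\<close>

locale walled_group = group G for G (structure) +
  fixes S :: "'s set" and X :: "'s \<Rightarrow> 'a set" and h :: "'a \<Rightarrow> 'a \<times> ('a set \<Rightarrow> 'a)"
  assumes subgroup_X: "s \<in> S \<Longrightarrow> subgroup (X s) G"
    and generates: "carrier G \<subseteq> generate G (\<Union>s\<in>S. X s)"
    and hom_h: "h \<in> hom G (crossing_group G)"
    and h_letter: "\<lbrakk>s \<in> S; x \<in> X s\<rbrakk> \<Longrightarrow> h x = crossing G (X s) x"
begin

abbreviation words :: "'s set \<Rightarrow> ('s \<times> 'a) list set" where
  "words I \<equiv> lists (SIGMA s:I. X s)"

abbreviation val :: "('s \<times> 'a) list \<Rightarrow> 'a" where
  "val \<equiv> word_prod G snd"

abbreviation std :: "'s set \<Rightarrow> 'a set" where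
  "std I \<equiv> generate G (\<Union>s\<in>I. X s)"

lemma X_carrier: "s \<in> S \<Longrightarrow> X s \<subseteq> carrier G"
  using subgroup.subset[OF subgroup_X] .

lemma letters_closed: "u \<in> words S \<Longrightarrow> snd ` set u \<subseteq> carrier G"
  using X_carrier by fastforce

lemma val_closed [simp]: "u \<in> words S \<Longrightarrow> val u \<in> carrier G"
  by (intro word_prod_closed letters_closed)

lemma val_append: "\<lbrakk>u \<in> words S; v \<in> words S\<rbrakk> \<Longrightarrow> val (u @ v) = val u \<otimes> val v"
  by (intro word_prod_append letters_closed)

lemma std_eq_words: "I \<subseteq> S \<Longrightarrow> std I = val ` words I"
  using subgroup_X by (intro generate_eq_words) auto

lemma subgroup_std: "I \<subseteq> S \<Longrightarrow> subgroup (std I) G"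
  using X_carrier by (intro generate_is_subgroup) auto

lemma X_le_std: "s \<in> I \<Longrightarrow> X s \<subseteq> std I"
  by (auto intro: generate.incl)

text \<open>
  If the wall crossed by a letter is itself one of the subgroups \<open>X s\<close>, the letter can be moved to
  the front of the word as an element of \<open>X s\<close>. This is how words are shortened below.
\<close>

lemma val_insert_crossed:
  assumes "u \<in> words S" "v \<in> words S" "s \<in> S" "x \<in> X s"
  shows "val (u @ (s, x) # v) = conj_by G (val u) x \<otimes> val (u @ v)"
proof -
  have "x \<in> carrier G" using assms X_carrier by blast
  then show ?thesis
    using assms by (simp add: val_append conj_by_mult_left flip: m_assoc)
qed

lemma fst_h_val: "u \<in> words S \<Longrightarrow> fst (h (val u)) = val u"
proof (induction u rule: rev_induct)
  case Nil
  interpret h: group_hom G "crossing_group G" h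
    using hom_h group_crossing_group by (simp add: group_hom_def group_hom_axioms_def is_group)
  show ?case using h.hom_one by (simp add: crossing_one)
next
  case (snoc l u)
  obtain s x where l: "l = (s, x)" "s \<in> S" "x \<in> X s" using snoc.prems by auto
  moreover have "x \<in> carrier G" using l X_carrier by blast
  ultimately show ?case
    using snoc hom_h by (simp add: val_append hom_mult h_letter fst_mult_crossing)
qed

text \<open>
  Since the record can be computed from any word, a wall at which an element registers is crossed
  by every word for that element. This plays the role of the exchange condition.
\<close>

lemma crossed_if_nontrivial:
  assumes "u \<in> words S" "T \<subseteq> carrier G" "snd (h (val u)) T \<noteq> \<one>"
  shows "\<exists>a s x b. u = a @ (s, x) # b \<and> conj_by G (val a) ` X s = T"
  using assms(1,3)
proof (induction u rule: rev_induct)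
  case Nil
  interpret h: group_hom G "crossing_group G" h
    using hom_h group_crossing_group by (simp add: group_hom_def group_hom_axioms_def is_group)
  show ?case using Nil h.hom_one assms(2) by (simp add: crossing_one)
next
  case (snoc l u)
  obtain s x where l: "l = (s, x)" "s \<in> S" "x \<in> X s" using snoc.prems by auto
  have u: "u \<in> words S" and x: "x \<in> carrier G" using snoc.prems l X_carrier by auto
  have "h (val (u @ [l])) = h (val u) \<otimes>\<^bsub>crossing_group G\<^esub> crossing G (X s) x"
    using l x u hom_h by (simp add: val_append hom_mult h_letter)
  then have *: "snd (h (val (u @ [l]))) T
      = (if T = conj_by G (val u) ` X s then conj_by G (val u) x else \<one>) \<otimes> snd (h (val u)) T"
    using snd_mult_crossing[of "h (val u)" x "X s" T] l u x X_carrier assms(2)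
    by (simp add: fst_h_val)
  show ?case
  proof (cases "T = conj_by G (val u) ` X s")
    case True
    then show ?thesis using l by blast
  next
    case False
    then have "snd (h (val u)) T \<noteq> \<one>" using * snoc.prems(2) by auto
    then obtain a t y b where "u = a @ (t, y) # b" "conj_by G (val a) ` X t = T"
      using snoc.IH u by blast
    then have "u @ [l] = a @ (t, y) # (b @ [l]) \<and> conj_by G (val a) ` X t = T" by simp
    then show ?thesis by blast
  qed
qed

text \<open>
  Let \<open>w = val b\<close> have minimal length in its coset \<open>W\<^sub>I w\<close>, where \<open>W\<^sub>I\<close> is \<open>std I\<close>, and let
  \<open>u \<in> W\<^sub>I \<inter> w W\<^sub>J w\<inverse>\<close>. Write \<open>u\<close> as a shortest possible word \<open>(s, x) # a'\<close> with letters from \<open>I\<close>.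
  In the word \<open>(s, x) # a' @ b\<close> the wall \<open>X s\<close> is crossed by no letter after the first: a letter of
  \<open>a'\<close> crossing it could be merged into \<open>x\<close>, and a letter of \<open>b\<close> crossing it could be deleted at the
  cost of a factor from \<open>W\<^sub>I\<close>, against the minimality of \<open>w\<close>. Hence \<open>u w\<close> registers \<open>x\<close> at the wall
  \<open>X s\<close>, and \<open>x\<close> may be taken to be nontrivial. But \<open>u w = w v\<close> with \<open>v \<in> W\<^sub>J\<close>, so the wall
  \<open>X s\<close> is also crossed by the word \<open>b @ c\<close>, where \<open>c\<close> is a word for \<open>v\<close> with letters from \<open>J\<close>.
  The crossing does not happen in \<open>b\<close>, hence it happens in \<open>c\<close>, so \<open>w\<inverse> X s w\<close> is a wall of \<open>W\<^sub>J\<close> and in particular a subset of \<open>W\<^sub>J\<close>. Thus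
  \<open>s \<in> K\<close>, the letter \<open>x\<close> lies in the intersection, and an induction on the length takes care of
  \<open>a'\<close>.
\<close>

lemma std_Int_conj_std:
  assumes I: "I \<subseteq> S" and J: "J \<subseteq> S" and b: "b \<in> words S"
    and min: "\<And>u v. \<lbrakk>u \<in> std I; v \<in> words S; val v = u \<otimes> val b\<rbrakk> \<Longrightarrow> length b \<le> length v"
  defines "K \<equiv> {s \<in> I. conj_by G (inv (val b)) ` X s \<subseteq> std J}"
  shows "std I \<inter> conj_by G (val b) ` std J = std K"
proof
  let ?w = "val b"
  have K: "K \<subseteq> I" by (auto simp: K_def)
  note sI = subgroup_std[OF I] and sJ = subgroup_std[OF J]
  have w: "?w \<in> carrier G" using b by simp
  have stdJ: "std J \<subseteq> carrier G" using subgroup.subset[OF sJ] .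
  have stdI: "std I \<subseteq> carrier G" using subgroup.subset[OF sI] .
  have XS: "X s \<subseteq> conj_by G ?w ` std J" if "s \<in> K" for s
  proof -
    have "X s = conj_by G ?w ` conj_by G (inv ?w) ` X s"
      using that K I X_carrier w by (metis conj_by_image_inv_cancel(2) subsetD)
    also have "\<dots> \<subseteq> conj_by G ?w ` std J"
      using that by (intro image_mono) (auto simp: K_def)
    finally show ?thesis .
  qed
  have sub_conj: "subgroup (conj_by G ?w ` std J) G"
    using w sJ by (rule subgroup_conj_by_image)
  show "std K \<subseteq> std I \<inter> conj_by G ?w ` std J"
  proof (rule generate_subgroup_incl)
    show "subgroup (std I \<inter> conj_by G ?w ` std J) G"
      using sI sub_conj by (rule subgroups_Inter_pair)
    show "(\<Union>s\<in>K. X s) \<subseteq> std I \<inter> conj_by G ?w ` std J"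
      using XS X_le_std[of _ I] K by blast
  qed
  have "val a \<in> std K" if "a \<in> words I" "val a \<in> conj_by G ?w ` std J" for a
    using that
  proof (induction a rule: length_induct)
    case (1 a)
    show ?case
    proof (cases "\<exists>a'\<in>words I. length a' < length a \<and> val a' = val a")
      case True
      then show ?thesis using 1 by metis
    next
      case amin: False
      show ?thesis
      proof (cases a)
        case Nil
        then show ?thesis by (simp add: generate.one)
      next
        case (Cons l a')
        then obtain s x where a: "a = (s, x) # a'" and s: "s \<in> I" and x: "x \<in> X s"
          and a': "a' \<in> words I"
          using 1(2) by auto
        have sS: "s \<in> S" and a'S: "a' \<in> words S" and xG: "x \<in> carrier G"
          using s a' I x X_carrier by auto
        note Xs = subgroup_X[OF sS]
        have "val a' \<in> std I" using a' by (simp add: std_eq_words[OF I])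
        \<comment> \<open>A letter \<open>y\<close> of \<open>a'\<close> crossing \<open>X s\<close> could be moved to the front and merged with \<open>x\<close>.\<close>
        have wall_not_in_a': "conj_by G (val p) ` X t \<noteq> X s"
          if p: "a' = p @ (t, y) # q" for p t y q
        proof
          assume wall: "conj_by G (val p) ` X t = X s"
          have pq: "p \<in> words I" "q \<in> words I" "t \<in> I" "y \<in> X t"
            using a' p by auto
          then have pqS: "p \<in> words S" "q \<in> words S" "t \<in> S" using I by auto
          have z: "conj_by G (val p) y \<in> X s" using wall pq by blast
          then have "x \<otimes> conj_by G (val p) y \<in> X s"
            using x subgroup.m_closed[OF Xs] by blast
          moreover have "val ((s, x \<otimes> conj_by G (val p) y) # p @ q) = val a"
            using pq pqS p a z xG sS X_carrier
            by (simp add: val_insert_crossed m_assoc subset_iff)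
          ultimately have "\<exists>a'\<in>words I. length a' < length a \<and> val a' = val a"
            using pq s a p by (intro bexI[of _ "(s, x \<otimes> conj_by G (val p) y) # p @ q"]) auto
          then show False using amin by blast
        qed
        \<comment> \<open>The factor \<open>g \<in> W\<^sub>I\<close> is \<open>val a'\<close> in the word \<open>a' @ b\<close> and \<open>\<one>\<close> in the word \<open>b @ c\<close>.\<close>
        have wall_not_in_b: "conj_by G (g \<otimes> val p) ` X t \<noteq> X s"
          if p: "b = p @ (t, y) # q" and g: "g \<in> std I" for p t y q g
        proof
          assume wall: "conj_by G (g \<otimes> val p) ` X t = X s"
          have pq: "p \<in> words S" "q \<in> words S" "t \<in> S" "y \<in> X t"
            using b p by auto
          have gG: "g \<in> carrier G" and y: "y \<in> carrier G" using g stdI pq X_carrier by auto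
          define z where "z = conj_by G (val p) y"
          have "conj_by G g z \<in> X s" using wall pq gG y
            by (auto simp: z_def simp flip: conj_by_comp)
          then have "conj_by G g z \<in> std I" using X_le_std s by blast
          then have "conj_by G (inv g) (conj_by G g z) \<in> std I"
            using g sI unfolding conj_by_def[of G "inv g"]
            by (intro subgroup.m_closed[OF sI] subgroup.m_inv_closed[OF sI])
          moreover have zG: "z \<in> carrier G" using pq y by (simp add: z_def)
          ultimately have "z \<in> std I" using gG by simp
          then have "inv z \<in> std I" using subgroup.m_inv_closed[OF sI] by blast
          moreover have "?w = z \<otimes> val (p @ q)"
            using pq p by (simp add: val_insert_crossed z_def)
          then have "val (p @ q) = inv z \<otimes> ?w"
            using pq zG by (simp flip: m_assoc)
          ultimately have "length b \<le> length (p @ q)"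
            using pq by (intro min) auto
          then show False using p by simp
        qed
        have "snd (h (val (a' @ b))) (X s) = \<one>"
        proof (rule ccontr)
          assume "snd (h (val (a' @ b))) (X s) \<noteq> \<one>"
          then obtain p t y q where split: "a' @ b = p @ (t, y) # q"
            and wall: "conj_by G (val p) ` X t = X s"
            using crossed_if_nontrivial[of "a' @ b" "X s"] a'S b X_carrier sS by auto
          from split consider q' where "a' = p @ (t, y) # q'"
            | p' where "p = a' @ p'" "b = p' @ (t, y) # q"
            by (blast dest: append_eq_append_ConsD)
          then show False
          proof cases
            case 1
            then show False using wall_not_in_a' wall by blast
          next
            case (2 p')
            then have "val p = val a' \<otimes> val p'" using a'S b by (simp add: val_append)
            then show False using wall_not_in_b[OF 2(2) \<open>val a' \<in> std I\<close>] wall by simp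
          qed
        qed
        moreover have "val a \<otimes> ?w = x \<otimes> val (a' @ b)"
          using a a'S b xG by (simp add: val_append m_assoc)
        ultimately have crossed: "snd (h (val a \<otimes> ?w)) (X s) = x"
          using snd_crossing_mult[OF Xs x] hom_h xG a'S b sS x
          by (simp add: hom_mult h_letter)
        obtain v where v: "v \<in> std J" "val a = conj_by G ?w v" using 1(3) by blast
        then obtain c where c: "c \<in> words J" "v = val c" using std_eq_words[OF J] by blast
        have cS: "c \<in> words S" using c J by auto
        have bc: "val (b @ c) = val a \<otimes> ?w"
          using v c w cS b by (simp add: val_append conj_by_mult_left)
        have xK: "x \<in> std K"
        proof (cases "x = \<one>")
          case True
          then show ?thesis by (simp add: generate.one)
        next
          case False
          then obtain p t y q where split: "b @ c = p @ (t, y) # q"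
            and wall: "conj_by G (val p) ` X t = X s"
            using crossed_if_nontrivial[of "b @ c" "X s"] crossed bc cS b X_carrier sS by auto
          from split consider q' where "b = p @ (t, y) # q'"
            | p' where "p = b @ p'" "c = p' @ (t, y) # q"
            by (blast dest: append_eq_append_ConsD)
          then have "conj_by G (inv ?w) ` X s \<subseteq> std J"
          proof cases
            case (1 q')
            then show ?thesis
              using wall_not_in_b[OF 1, of \<one>] wall b by (simp add: generate.one)
          next
            case (2 p')
            then have p': "p' \<in> words J" "t \<in> J" using c by auto
            then have p'S: "p' \<in> words S" "t \<in> S" "val p' \<in> std J"
              using J std_eq_words[OF J] by auto
            have "X s = conj_by G ?w ` conj_by G (val p') ` X t"
              using wall 2 p'S b X_carrier by (simp add: val_append conj_by_image_comp)
            then have "conj_by G (inv ?w) ` X s = conj_by G (val p') ` X t"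
              using w p'S X_carrier by (simp add: conj_by_image_closed)
            also have "\<dots> \<subseteq> conj_by G (val p') ` std J"
              using X_le_std p' by (intro image_mono) auto
            also have "\<dots> = std J" by (rule conj_by_image_subgroup[OF sJ p'S(3)])
            finally show ?thesis .
          qed
          then have "s \<in> K" using s by (simp add: K_def)
          then show ?thesis using X_le_std x by blast
        qed
        have "val a' = inv x \<otimes> val a" using a xG a'S by (simp flip: m_assoc)
        moreover have "inv x \<in> conj_by G ?w ` std J"
        proof -
          have "x \<in> conj_by G ?w ` std J"
            using xK \<open>std K \<subseteq> std I \<inter> conj_by G ?w ` std J\<close> by blast
          then show ?thesis using subgroup.m_inv_closed[OF sub_conj] by blast
        qed
        ultimately have "val a' \<in> conj_by G ?w ` std J"
          using 1(3) subgroup.m_closed[OF sub_conj] by simp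
        then have "val a' \<in> std K" using 1(1) a a' by simp
        then show ?thesis using xK a by (simp add: generate.eng)
      qed
    qed
  qed
  then show "std I \<inter> conj_by G ?w ` std J \<subseteq> std K"
    using std_eq_words[OF I] by auto
qed


text \<open>
  After conjugation, one of the two parabolic subgroups is standard, say \<open>W\<^sub>I\<close>, and the other one
  is \<open>w W\<^sub>J w\<inverse>\<close>. A further conjugation by an element of \<open>W\<^sub>I\<close> preserves the first one and moves \<open>w\<close>
  to an element of minimal length in \<open>W\<^sub>I w\<close>, for which the intersection has been computed.
\<close>

theorem parabolic_subgroup_Int:
  assumes "parabolic_subgroup G S X P" "parabolic_subgroup G S X Q"
  shows "parabolic_subgroup G S X (P \<inter> Q)"
proof -
  obtain g I where g: "g \<in> carrier G" and I: "I \<subseteq> S" and P: "P = conj_by G g ` std I"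
    using assms(1) by (auto simp: parabolic_subgroup_def coset_conj_eq)
  obtain k J where k: "k \<in> carrier G" and J: "J \<subseteq> S" and Q: "Q = conj_by G k ` std J"
    using assms(2) by (auto simp: parabolic_subgroup_def coset_conj_eq)
  have stdI: "std I \<subseteq> carrier G" and stdJ: "std J \<subseteq> carrier G"
    using subgroup.subset subgroup_std I J by blast+
  define w where "w = inv g \<otimes> k"
  have w: "w \<in> carrier G" using g k by (simp add: w_def)
  define B where "B v \<longleftrightarrow> v \<in> words S \<and> (\<exists>u\<in>std I. val v = u \<otimes> w)" for v
  have "w \<in> val ` words S" using subsetD[OF generates w] by (simp only: std_eq_words[OF order.refl])
  then obtain v where v: "v \<in> words S" "val v = w" by auto
  have "B v"
    unfolding B_def using v w generate.one[of G "\<Union>s\<in>I. X s"] by (intro conjI bexI[of _ \<one>]) auto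
  then obtain b where "B b" and b_min: "\<And>v. B v \<Longrightarrow> length b \<le> length v"
    using ex_has_least_nat[of B v length] by blast
  then obtain u where b: "b \<in> words S" and u: "u \<in> std I" "val b = u \<otimes> w"
    by (auto simp: B_def)
  have uG: "u \<in> carrier G" using u stdI by blast
  define K where "K = {s \<in> I. conj_by G (inv (val b)) ` X s \<subseteq> std J}"
  have core: "std I \<inter> conj_by G (val b) ` std J = std K"
    unfolding K_def
  proof (rule std_Int_conj_std[OF I J b])
    fix u' v assume u': "u' \<in> std I" and v: "v \<in> words S" "val v = u' \<otimes> val b"
    have "val v = (u' \<otimes> u) \<otimes> w" using v(2) u u' uG stdI w by (simp add: m_assoc subset_iff)
    moreover have "u' \<otimes> u \<in> std I" using u' u(1) by (rule generate.eng)
    ultimately show "length b \<le> length v" using v(1) by (intro b_min) (auto simp: B_def)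
  qed
  define g' where "g' = g \<otimes> inv u"
  have g': "g' \<in> carrier G" using g uG by (simp add: g'_def)
  have "P = conj_by G g' ` std I"
  proof -
    have "inv u \<in> std I" using u(1) subgroup_std[OF I] by (rule subgroup.m_inv_closed[rotated])
    then show ?thesis
      using g uG stdI
      by (simp add: P g'_def conj_by_image_comp conj_by_image_subgroup[OF subgroup_std[OF I]])
  qed
  moreover have "k = g' \<otimes> val b"
  proof -
    have "g' \<otimes> val b = g \<otimes> (inv u \<otimes> (u \<otimes> (inv g \<otimes> k)))"
      using g uG k by (simp add: g'_def u w_def m_assoc)
    also have "\<dots> = k" using g uG k by (simp flip: m_assoc)
    finally show ?thesis by simp
  qed
  then have "Q = conj_by G g' ` conj_by G (val b) ` std J"
    using g' b stdJ by (simp add: Q conj_by_image_comp)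
  ultimately have "P \<inter> Q = conj_by G g' ` std K"
    using g' stdI stdJ b by (simp add: conj_by_image_Int conj_by_image_closed flip: core)
  moreover have "K \<subseteq> S" using I by (auto simp: K_def)
  ultimately show ?thesis
    using g' by (auto simp: parabolic_subgroup_def coset_conj_eq)
qed

end

section \<open>Homomorphisms out of groups given by presentations\<close>

lemma word_quotient_lift:
  assumes H: "group H" and \<phi>: "\<phi> ` X \<subseteq> carrier H"
    and R: "\<And>l r. \<lbrakk>(l, r) \<in> R; l \<in> lists X; r \<in> lists X\<rbrakk> \<Longrightarrow> word_prod H \<phi> l = word_prod H \<phi> r"
  obtains h where "h \<in> hom (word_quotient X R) H"
    and "\<And>u. u \<in> lists X \<Longrightarrow> h (word_cong X R `` {u}) = word_prod H \<phi> u"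
proof -
  interpret H: group H by (rule H)
  have closed: "\<phi> ` set u \<subseteq> carrier H" if "u \<in> lists X" for u
    using that \<phi> by auto
  have inv: "word_prod H \<phi> u = word_prod H \<phi> v" if "(u, v) \<in> word_cong X R" for u v
    using that
  proof induction
    case (rel l r u v)
    then show ?case
      using R[of l r] closed[of u] closed[of l] closed[of r] closed[of v]
      by (simp add: H.word_prod_append image_Un)
  qed auto
  define h where "h A = word_prod H \<phi> (SOME u. u \<in> A)" for A
  have h: "h (word_cong X R `` {u}) = word_prod H \<phi> u" if "u \<in> lists X" for u
  proof -
    have "u \<in> word_cong X R `` {u}" using that by (simp add: word_cong.refl)
    then have "(SOME v. v \<in> word_cong X R `` {u}) \<in> word_cong X R `` {u}" by (rule someI)
    then show ?thesis using inv by (simp add: h_def)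
  qed
  have "h \<in> hom (word_quotient X R) H"
  proof (rule homI)
    fix A B assume "A \<in> carrier (word_quotient X R)" "B \<in> carrier (word_quotient X R)"
    then obtain u v where "u \<in> lists X" "A = word_cong X R `` {u}"
        "v \<in> lists X" "B = word_cong X R `` {v}"
      by (auto simp: word_quotient_def elim!: quotientE)
    then show "h (A \<otimes>\<^bsub>word_quotient X R\<^esub> B) = h A \<otimes>\<^bsub>H\<^esub> h B"
      using closed[of u] closed[of v] by (simp add: word_quotient_mult h H.word_prod_append)
  next
    fix A assume "A \<in> carrier (word_quotient X R)"
    then obtain u where "u \<in> lists X" "A = word_cong X R `` {u}"
      by (auto simp: word_quotient_def elim!: quotientE)
    then show "h A \<in> carrier H"
      using closed[of u] by (simp add: h H.word_prod_closed)
  qed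
  then show thesis using h that by blast
qed

lemma word_quotient_generated:
  "carrier (word_quotient X R) \<subseteq> generate (word_quotient X R) ((\<lambda>x. word_cong X R `` {[x]}) ` X)"
proof
  fix A assume "A \<in> carrier (word_quotient X R)"
  then obtain u where u: "u \<in> lists X" "A = word_cong X R `` {u}"
    by (auto simp: word_quotient_def elim!: quotientE)
  have "word_cong X R `` {u} \<in> generate (word_quotient X R) ((\<lambda>x. word_cong X R `` {[x]}) ` X)"
    using u(1)
  proof induction
    case Nil
    show ?case using generate.one[of "word_quotient X R"] by (simp add: word_quotient_def)
  next
    case (Cons x u)
    then have "word_cong X R `` {x # u}
        = word_cong X R `` {[x]} \<otimes>\<^bsub>word_quotient X R\<^esub> word_cong X R `` {u}"
      by (simp add: word_quotient_mult)
    then show ?case using Cons by (auto intro: generate.eng generate.incl)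
  qed
  then show "A \<in> generate (word_quotient X R) ((\<lambda>x. word_cong X R `` {[x]}) ` X)"
    by (simp add: u(2))
qed

lemma (in group) Mod_normal_closure_lift:
  assumes "A \<subseteq> carrier G" "group H" "h \<in> hom G H" "\<And>a. a \<in> A \<Longrightarrow> h a = \<one>\<^bsub>H\<^esub>"
  obtains k where "k \<in> hom (G Mod normal_closure G A) H"
    and "\<And>x. x \<in> carrier G \<Longrightarrow> k (normal_closure G A #> x) = h x"
proof -
  interpret h: group_hom G H h
    using assms by (simp add: group_hom_def group_hom_axioms_def is_group)
  have "normal_closure G A \<subseteq> kernel G H h"
    unfolding normal_closure_def using assms(1,4) h.normal_kernel
    by (intro Inter_lower) (auto simp: kernel_def)
  then show thesis
    using h.FactGroup_universal_kernel[OF normal_normal_closure[OF assms(1)]] that by blast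
qed

lemma (in normal) Mod_generated:
  assumes "carrier G \<subseteq> generate G Y" "Y \<subseteq> carrier G"
  shows "carrier (G Mod H) \<subseteq> generate (G Mod H) ((\<lambda>x. H #> x) ` Y)"
proof -
  interpret q: group_hom G "G Mod H" "\<lambda>x. H #> x"
    using r_coset_hom_Mod factorgroup_is_group
    by (simp add: group_hom_def group_hom_axioms_def is_group)
  have "carrier (G Mod H) = (\<lambda>x. H #> x) ` carrier G"
    by (auto simp: FactGroup_def RCOSETS_def)
  also have "\<dots> \<subseteq> (\<lambda>x. H #> x) ` generate G Y" using assms(1) by (rule image_mono)
  also have "\<dots> = generate (G Mod H) ((\<lambda>x. H #> x) ` Y)"
    by (rule q.generate_img[symmetric]) (rule assms(2))
  finally show ?thesis .
qed

section \<open>Relations between the records of single letters\<close>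

context group
begin

lemma crossing_mult_same:
  assumes X: "subgroup X G" and "x \<in> X" "y \<in> X"
  shows "crossing G X x \<otimes>\<^bsub>crossing_group G\<^esub> crossing G X y = crossing G X (x \<otimes> y)"
proof (rule crossing_group_eqI)
  interpret C: group "crossing_group G" by (rule group_crossing_group)
  have G: "x \<in> carrier G" "y \<in> carrier G" "X \<subseteq> carrier G"
    using assms subgroup.subset[OF X] by auto
  show "crossing G X x \<otimes>\<^bsub>crossing_group G\<^esub> crossing G X y \<in> carrier (crossing_group G)"
    "crossing G X (x \<otimes> y) \<in> carrier (crossing_group G)"
    using G by (auto simp: crossing_closed)
  show "fst (crossing G X x \<otimes>\<^bsub>crossing_group G\<^esub> crossing G X y) = fst (crossing G X (x \<otimes> y))"
    by (simp add: fst_mult_crossing) (simp add: crossing_def)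
  show "snd (crossing G X x \<otimes>\<^bsub>crossing_group G\<^esub> crossing G X y) T = snd (crossing G X (x \<otimes> y)) T"
    if T: "T \<subseteq> carrier G" for T
    using G T assms snd_mult_crossing[of "crossing G X x" y X T]
    by (auto simp: crossing_def conj_by_image_subgroup conj_by_mult_left)
qed

text \<open>
  If \<open>X\<close> and \<open>Y\<close> commute elementwise, reading \<open>x\<close> first does not move the wall of \<open>y\<close>, and conversely;
  so both orders register \<open>x\<close> at \<open>X\<close> and \<open>y\<close> at \<open>Y\<close>.
\<close>

lemma crossing_commute:
  assumes X: "subgroup X G" and Y: "subgroup Y G" and x: "x \<in> X" and y: "y \<in> Y"
    and comm: "\<And>x y. \<lbrakk>x \<in> X; y \<in> Y\<rbrakk> \<Longrightarrow> x \<otimes> y = y \<otimes> x"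
  shows "crossing G X x \<otimes>\<^bsub>crossing_group G\<^esub> crossing G Y y
       = crossing G Y y \<otimes>\<^bsub>crossing_group G\<^esub> crossing G X x"
proof (rule crossing_group_eqI)
  interpret C: group "crossing_group G" by (rule group_crossing_group)
  have sub: "X \<subseteq> carrier G" "Y \<subseteq> carrier G"
    using subgroup.subset X Y by auto
  have G: "x \<in> carrier G" "y \<in> carrier G" using sub x y by auto
  show "crossing G X x \<otimes>\<^bsub>crossing_group G\<^esub> crossing G Y y \<in> carrier (crossing_group G)"
    "crossing G Y y \<otimes>\<^bsub>crossing_group G\<^esub> crossing G X x \<in> carrier (crossing_group G)"
    using G by (auto simp: crossing_closed)
  show "fst (crossing G X x \<otimes>\<^bsub>crossing_group G\<^esub> crossing G Y y)
      = fst (crossing G Y y \<otimes>\<^bsub>crossing_group G\<^esub> crossing G X x)"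
    using comm[OF x y] by (simp add: fst_mult_crossing) (simp add: crossing_def)
  have fix1: "conj_by G a b = b" if "a \<in> carrier G" "b \<in> carrier G" "a \<otimes> b = b \<otimes> a" for a b
    using that by (simp add: conj_by_def m_assoc)
  have Yx: "conj_by G x b = b" if "b \<in> Y" for b
    using that comm[OF x] sub G by (intro fix1) auto
  have Xy: "conj_by G y a = a" if "a \<in> X" for a
    using that comm[OF _ y] sub G by (intro fix1) auto
  have img: "conj_by G x ` Y = Y" "conj_by G y ` X = X" using Yx Xy by auto
  show "snd (crossing G X x \<otimes>\<^bsub>crossing_group G\<^esub> crossing G Y y) T
      = snd (crossing G Y y \<otimes>\<^bsub>crossing_group G\<^esub> crossing G X x) T"
    if T: "T \<subseteq> carrier G" for T
    using G sub T snd_mult_crossing[of "crossing G X x" y Y T]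
      snd_mult_crossing[of "crossing G Y y" x X T] comm[OF x y]
    by (simp add: crossing_def img Yx Xy x y)
qed

lemma subgroup_involution:
  assumes "r \<in> carrier G" "r \<otimes> r = \<one>"
  shows "subgroup {\<one>, r} G"
  using assms inv_equality[of r r] by unfold_locales auto

end

lemma even_card_periodic:
  assumes "\<And>j. p (j + m) \<longleftrightarrow> p j"
  shows "even (card {j::nat. j < 2 * m \<and> p j})"
proof -
  have "{j. j < 2 * m \<and> p j} = {j. j < m \<and> p j} \<union> (\<lambda>j. j + m) ` {j. j < m \<and> p j}"
  proof (intro equalityI subsetI)
    fix j assume j: "j \<in> {j. j < 2 * m \<and> p j}"
    show "j \<in> {j. j < m \<and> p j} \<union> (\<lambda>j. j + m) ` {j. j < m \<and> p j}"
    proof (cases "j < m")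
      case False
      then show ?thesis using j assms[of "j - m"] by (intro UnI2 image_eqI[of _ _ "j - m"]) auto
    qed (use j in auto)
  qed (auto simp: assms)
  moreover have "card ({j. j < m \<and> p j} \<union> (\<lambda>j. j + m) ` {j. j < m \<and> p j})
      = card {j. j < m \<and> p j} + card ((\<lambda>j. j + m) ` {j. j < m \<and> p j})"
    by (rule card_Un_disjoint) auto
  moreover have "card ((\<lambda>j. j + m) ` {j. j < m \<and> p j}) = card {j. j < m \<and> p j}"
    by (rule card_image) simp
  ultimately show ?thesis by simp
qed

lemma card_less_Suc:
  "card {j. j < Suc n \<and> p j} = (if p n then Suc (card {j. j < n \<and> p j}) else card {j. j < n \<and> p j})"
proof -
  have "{j. j < Suc n \<and> p j} = (if p n then insert n {j. j < n \<and> p j} else {j. j < n \<and> p j})"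
    by (auto simp: less_Suc_eq)
  then show ?thesis by simp
qed

text \<open>
  With \<open>a = r s\<close>, the letters of the word \<open>r s r s \<dots>\<close> cross successively the walls \<open>{\<one>, t j}\<close> of the
  reflections \<open>t j = a\<^sup>j r\<close>. If \<open>a\<^sup>m = \<one>\<close>, then \<open>t\<close> has period \<open>m\<close>, so a word of length \<open>2 m\<close> crosses
  each wall \<open>{\<one>, x}\<close> an even number of times and registers an even power of the involution \<open>x\<close>.
\<close>

lemma (in group) crossing_dihedral_relation:
  fixes m :: nat
  assumes r: "r \<in> carrier G" "r \<otimes> r = \<one>" and s: "s \<in> carrier G" "s \<otimes> s = \<one>"
    and m: "(r \<otimes> s) [^] m = \<one>"
  shows "(crossing G {\<one>, r} r \<otimes>\<^bsub>crossing_group G\<^esub> crossing G {\<one>, s} s) [^]\<^bsub>crossing_group G\<^esub> m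
       = \<one>\<^bsub>crossing_group G\<^esub>" (is "?c [^]\<^bsub>?C\<^esub> m = _")
proof -
  interpret C: group ?C by (rule group_crossing_group)
  define a where "a = r \<otimes> s"
  define t where "t j = a [^] j \<otimes> r" for j :: nat
  have a: "a \<in> carrier G" and t: "t j \<in> carrier G" for j using r s by (simp_all add: a_def t_def)
  have rr: "r \<otimes> (r \<otimes> x) = x" and ss: "s \<otimes> (s \<otimes> x) = x" if "x \<in> carrier G" for x
    using that r s by (simp_all flip: m_assoc)
  \<comment> \<open>The reflection \<open>r\<close> inverts the rotation \<open>a\<close>.\<close>
  have flip: "a [^] k \<otimes> r \<otimes> a [^] k = r" for k :: nat
  proof (induction k)
    case (Suc k)
    have "a [^] Suc k \<otimes> r \<otimes> a [^] Suc k = (a [^] k \<otimes> a) \<otimes> r \<otimes> (a \<otimes> a [^] k)"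
      by (metis nat_pow_Suc nat_pow_Suc2[OF a])
    also have "\<dots> = a [^] k \<otimes> (a \<otimes> r \<otimes> a) \<otimes> a [^] k"
      using a r by (simp add: m_assoc)
    also have "a \<otimes> r \<otimes> a = r" using r s by (simp add: a_def m_assoc rr ss)
    finally show ?case using Suc by simp
  qed (use r in simp)
  have flip': "r \<otimes> inv (a [^] k) = a [^] k \<otimes> r" for k :: nat
    using flip[of k] a r by (simp add: inv_solve_right')
  have inv_r: "inv r = r" using r by (simp add: inv_equality)
  \<comment> \<open>The wall crossed by \<open>r\<close> after the prefix \<open>a\<^sup>k\<close>, and the one crossed by the next letter \<open>s\<close>.\<close>
  have even_wall: "conj_by G (a [^] k) r = t (2 * k)" for k
    using a r by (simp add: conj_by_def t_def m_assoc flip' mult_2 flip: nat_pow_mult)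
  have odd_wall: "conj_by G (a [^] k \<otimes> r) s = t (Suc (2 * k))" for k
  proof -
    have "conj_by G (a [^] k \<otimes> r) s = a [^] k \<otimes> a \<otimes> (r \<otimes> inv (a [^] k))"
      using a r s by (simp add: conj_by_def inv_mult_group inv_r m_assoc) (simp add: a_def m_assoc)
    also have "\<dots> = a [^] Suc k \<otimes> a [^] k \<otimes> r" using a r by (simp add: flip' m_assoc)
    also have "\<dots> = t (Suc (2 * k))"
      using nat_pow_mult[OF a, of "Suc k" k] by (simp add: t_def mult_2)
    finally show ?thesis .
  qed
  have t_sq: "t j \<otimes> t j = \<one>" for j
    using flip[of j] a r by (simp add: t_def) (simp flip: m_assoc)
  have c: "?c \<in> carrier ?C" using r s by (simp add: crossing_closed)
  have fst_pow: "fst (?c [^]\<^bsub>?C\<^esub> k) = a [^] k" for k :: nat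
  proof (induction k)
    case 0
    show ?case by (simp add: crossing_one)
  next
    case (Suc k)
    then show ?case
      using c r s a by (simp add: fst_mult_crossing crossing_closed m_assoc a_def flip: C.m_assoc)
  qed
  have step: "snd (?c [^]\<^bsub>?C\<^esub> Suc k) T =
      (if T = {\<one>, t (Suc (2 * k))} then t (Suc (2 * k)) else \<one>) \<otimes>
      ((if T = {\<one>, t (2 * k)} then t (2 * k) else \<one>) \<otimes> snd (?c [^]\<^bsub>?C\<^esub> k) T)"
    if T: "T \<subseteq> carrier G" for T k
  proof -
    let ?p = "?c [^]\<^bsub>?C\<^esub> k" and ?r = "crossing G {\<one>, r} r" and ?s = "crossing G {\<one>, s} s"
    have "?c [^]\<^bsub>?C\<^esub> Suc k = ?p \<otimes>\<^bsub>?C\<^esub> ?r \<otimes>\<^bsub>?C\<^esub> ?s"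
      using c r s by (simp add: crossing_closed C.m_assoc)
    moreover have "fst (?p \<otimes>\<^bsub>?C\<^esub> ?r) = a [^] k \<otimes> r" by (simp add: fst_mult_crossing fst_pow)
    ultimately show ?thesis
      using snd_mult_crossing[of "?p \<otimes>\<^bsub>?C\<^esub> ?r" s "{\<one>, s}" T]
        snd_mult_crossing[of ?p r "{\<one>, r}" T] a r s T
      by (simp add: fst_pow even_wall odd_wall)
  qed
  \<comment> \<open>The set \<open>{\<one>, x}\<close> determines \<open>x\<close>, so it is the wall number \<open>j\<close> exactly when \<open>t j = x\<close>.\<close>
  have wall: "snd (?c [^]\<^bsub>?C\<^esub> k) {\<one>, x} = x [^] card {j. j < 2 * k \<and> t j = x}"
    if x: "x \<in> carrier G" for x and k :: nat
  proof (induction k)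
    case 0
    show ?case using x by (simp add: crossing_one)
  next
    case (Suc k)
    have eq: "{\<one>, x} = {\<one>, y} \<longleftrightarrow> y = x" for y by (auto simp: doubleton_eq_iff)
    show ?case
      unfolding step[OF insert_subsetI[OF one_closed], OF insert_subsetI[OF x empty_subsetI]] eq Suc
      using x t nat_pow_Suc2[OF x] by (auto simp: card_less_Suc simp del: nat_pow_Suc)
  qed
  have no_wall: "snd (?c [^]\<^bsub>?C\<^esub> k) T = \<one>"
    if "T \<subseteq> carrier G" "\<And>x. x \<in> carrier G \<Longrightarrow> T \<noteq> {\<one>, x}" for T and k :: nat
  proof (induction k)
    case 0
    show ?case using that by (simp add: crossing_one)
  next
    case (Suc k)
    then show ?case using that t unfolding step[OF that(1)] by simp
  qed
  show ?thesis
  proof (rule crossing_group_eqI)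
    show "?c [^]\<^bsub>?C\<^esub> m \<in> carrier ?C" using c by simp
    show "fst (?c [^]\<^bsub>?C\<^esub> m) = fst \<one>\<^bsub>?C\<^esub>" using m by (simp add: fst_pow crossing_one a_def)
    fix T assume T: "T \<subseteq> carrier G"
    have "snd (?c [^]\<^bsub>?C\<^esub> m) T = \<one>"
    proof (cases "\<exists>x\<in>carrier G. T = {\<one>, x}")
      case True
      then obtain x where x: "x \<in> carrier G" "T = {\<one>, x}" by blast
      let ?n = "card {j. j < 2 * m \<and> t j = x}"
      have "t (j + m) = t j" for j
        using a m r by (simp add: t_def flip: nat_pow_mult) (simp add: a_def)
      then have "even ?n" by (intro even_card_periodic) simp
      moreover have "x \<otimes> x = \<one> \<or> ?n = 0"
        using t_sq by (cases "\<exists>j. t j = x") auto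
      ultimately have "x [^] ?n = \<one>"
      proof (elim disjE)
        assume "even ?n" "x \<otimes> x = \<one>"
        then obtain b where "?n = 2 * b" by (elim evenE)
        then have "x [^] ?n = (x [^] (2::nat)) [^] b" using x(1) by (simp only: nat_pow_pow)
        also have "x [^] (2::nat) = \<one>" using x(1) \<open>x \<otimes> x = \<one>\<close> by (simp add: numeral_2_eq_2)
        finally show ?thesis by simp
      next
        assume "?n = 0"
        then show ?thesis by (simp only: nat_pow_0)
      qed
      then show ?thesis by (simp only: wall[OF x(1), of m] x(2))
    next
      case False
      then show ?thesis using no_wall T by blast
    qed
    then show "snd (?c [^]\<^bsub>?C\<^esub> m) T = snd \<one>\<^bsub>?C\<^esub> T" using T by (simp add: crossing_one)
  qed simp
qed

text \<open>
  Standard parabolic subgroups of a Coxeter group are generated by single elements \<open>s\<close>, those of the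
  general theorem by the subgroups \<open>{\<one>, s}\<close>. This reconciles the two.
\<close>

lemma (in group) generate_insert_one:
  assumes "\<And>s. s \<in> I \<Longrightarrow> Y s \<subseteq> carrier G"
  shows "generate G (\<Union>s\<in>I. insert \<one> (Y s)) = generate G (\<Union>s\<in>I. Y s)"
proof
  have "subgroup (generate G (\<Union>s\<in>I. Y s)) G"
    using assms by (intro generate_is_subgroup) auto
  then show "generate G (\<Union>s\<in>I. insert \<one> (Y s)) \<subseteq> generate G (\<Union>s\<in>I. Y s)"
    by (rule generate_subgroup_incl[rotated]) (auto intro: generate.one generate.incl)
  show "generate G (\<Union>s\<in>I. Y s) \<subseteq> generate G (\<Union>s\<in>I. insert \<one> (Y s))"
    by (rule mono_generate) auto
qed

section \<open>Coxeter groups\<close>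

lemma normal_coxeter_kernel: "coxeter_kernel S M \<lhd> free_group S"
  unfolding coxeter_kernel_def
  by (intro group.normal_normal_closure group_free_group)
    (auto simp: coxeter_relators_def free_group_gen_closed
      intro!: monoid.nat_pow_closed monoid.m_closed group.is_monoid group_free_group)

text \<open>
  The subgroup attached to the generator \<open>s\<close> is \<open>{\<one>, s}\<close>, and its letters register according to the
  number of crossings modulo two, as in the classical permutation action on reflections and signs.
  The defining relations hold for these records by \<open>crossing_dihedral_relation\<close>.
\<close>

theorem coxeter_parabolic_Int:
  assumes M: "coxeter_matrix S M" and P: "coxeter_parabolic S M P" and Q: "coxeter_parabolic S M Q"
  shows "coxeter_parabolic S M (P \<inter> Q)"
proof -
  let ?F = "free_group S" and ?W = "coxeter_group S M" and ?N = "coxeter_kernel S M"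
  let ?X = "S \<times> (UNIV :: bool set)" and ?R = "free_group_rels S"
  let ?C = "crossing_group ?W" and ?g = "coxeter_gen S M" and ?f = "free_group_gen S"
  interpret F: group ?F by (rule group_free_group)
  interpret W: group ?W by (rule group_coxeter_group)
  interpret C: group ?C by (rule W.group_crossing_group)
  interpret N: normal ?N ?F by (rule normal_coxeter_kernel)
  let ?q = "\<lambda>x. ?N #>\<^bsub>?F\<^esub> x"
  interpret q: group_hom ?F ?W ?q
    using N.r_coset_hom_Mod by unfold_locales (simp add: coxeter_group_def)
  have f: "?f s \<in> carrier ?F" if "s \<in> S" for s using that by (rule free_group_gen_closed)
  have g: "?g s = ?q (?f s)" for s by (simp add: coxeter_gen_def)
  have gW: "?g s \<in> carrier ?W" if "s \<in> S" for s using f[OF that] by (simp add: g)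
  have relators: "coxeter_relators S M \<subseteq> carrier ?F"
    using f by (auto simp: coxeter_relators_def)
  have rel: "(?g r \<otimes>\<^bsub>?W\<^esub> ?g s) [^]\<^bsub>?W\<^esub> m = \<one>\<^bsub>?W\<^esub>"
    if "r \<in> S" "s \<in> S" "M r s = enat m" for r s m
  proof -
    have "(?f r \<otimes>\<^bsub>?F\<^esub> ?f s) [^]\<^bsub>?F\<^esub> m \<in> coxeter_relators S M"
      using that by (auto simp: coxeter_relators_def)
    also have "\<dots> \<subseteq> ?N" by (auto simp: coxeter_kernel_def normal_closure_def)
    finally have "?q ((?f r \<otimes>\<^bsub>?F\<^esub> ?f s) [^]\<^bsub>?F\<^esub> m) = \<one>\<^bsub>?W\<^esub>"
      by (simp add: coxeter_group_def FactGroup_def F.coset_join2 N.is_subgroup N.mem_carrier)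
    then show ?thesis using that f by (simp add: g q.hom_nat_pow)
  qed
  have invol: "?g s \<otimes>\<^bsub>?W\<^esub> ?g s = \<one>\<^bsub>?W\<^esub>" if "s \<in> S" for s
    using rel[of s s 1] that M gW by (simp add: coxeter_matrix_def one_enat_def)
  define X where "X s = {\<one>\<^bsub>?W\<^esub>, ?g s}" for s
  have X: "subgroup (X s) ?W" if "s \<in> S" for s
    unfolding X_def using gW invol that by (intro W.subgroup_involution) auto
  \<comment> \<open>A generator and its inverse have the same image in the Coxeter group, so both letters of the
    free group receive the same record.\<close>
  define \<phi> where "\<phi> l = crossing ?W (X (fst l)) (?g (fst l))" for l :: "'a \<times> bool"
  have \<phi>: "\<phi> ` ?X \<subseteq> carrier ?C"
    using gW by (auto simp: \<phi>_def W.crossing_closed)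
  have "word_prod ?C \<phi> l = word_prod ?C \<phi> r" if lr: "(l, r) \<in> ?R" for l r
  proof -
    obtain s b where s: "s \<in> S" "l = [(s, b), (s, \<not> b)]" "r = []"
      using lr unfolding free_group_rels_def by blast
    have "crossing ?W (X s) (?g s) \<otimes>\<^bsub>?C\<^esub> crossing ?W (X s) (?g s) = \<one>\<^bsub>?C\<^esub>"
      using W.crossing_mult_same[OF X[OF s(1)]] invol[OF s(1)] W.crossing_of_one
      by (simp add: X_def)
    then show ?thesis using s gW by (simp add: \<phi>_def W.crossing_closed)
  qed
  then obtain h0 where h0: "h0 \<in> hom ?F ?C"
    and h0_word: "\<And>u. u \<in> lists ?X \<Longrightarrow> h0 (word_cong ?X ?R `` {u}) = word_prod ?C \<phi> u"
    using word_quotient_lift[OF C.is_group \<phi>, of ?R] unfolding free_group_def by blast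
  interpret h0: group_hom ?F ?C h0
    using h0 by unfold_locales
  have h0_gen: "h0 (?f s) = crossing ?W (X s) (?g s)" if "s \<in> S" for s
    using that gW by (simp add: free_group_gen_def h0_word \<phi>_def W.crossing_closed)
  have "h0 x = \<one>\<^bsub>?C\<^esub>" if relator: "x \<in> coxeter_relators S M" for x
  proof -
    obtain r s m where x: "x = (?f r \<otimes>\<^bsub>?F\<^esub> ?f s) [^]\<^bsub>?F\<^esub> m"
      and rs: "r \<in> S" "s \<in> S" "M r s = enat m"
      using relator by (auto simp: coxeter_relators_def)
    then show ?thesis
      using f gW invol rel W.crossing_dihedral_relation[of "?g r" "?g s" m]
      by (simp add: h0.hom_nat_pow h0_gen X_def)
  qed
  then obtain h where h: "h \<in> hom ?W ?C" and h_q: "\<And>x. x \<in> carrier ?F \<Longrightarrow> h (?q x) = h0 x"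
    using F.Mod_normal_closure_lift[OF relators C.is_group h0]
    unfolding coxeter_group_def coxeter_kernel_def by blast
  interpret h: group_hom ?W ?C h
    using h by unfold_locales
  have h_gen: "h (?g s) = crossing ?W (X s) (?g s)" if "s \<in> S" for s
    using h_q[OF f[OF that]] h0_gen[OF that] by (simp flip: g)
  have gen_X: "generate ?W (\<Union>s\<in>I. X s) = generate ?W (\<Union>s\<in>I. {?g s})" if "I \<subseteq> S" for I
    unfolding X_def using gW that by (intro W.generate_insert_one) auto
  have "walled_group ?W S X h"
  proof (intro walled_group.intro walled_group_axioms.intro W.is_group X h)
    show "h x = crossing ?W (X s) x" if "s \<in> S" "x \<in> X s" for s x
      using that h_gen h.hom_one W.crossing_of_one by (auto simp: X_def)
    let ?L = "(\<lambda>x. word_cong ?X ?R `` {[x]}) ` ?X"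
    have L: "carrier ?F \<subseteq> generate ?F ?L"
      unfolding free_group_def by (rule word_quotient_generated)
    have LF: "?L \<subseteq> carrier ?F"
      by (auto simp: free_group_def word_quotient_def intro!: quotientI)
    have sub: "subgroup (generate ?W (\<Union>s\<in>S. X s)) ?W"
      using subgroup.subset[OF X] by (intro W.generate_is_subgroup) auto
    have "carrier ?W \<subseteq> generate ?W (?q ` ?L)"
      using N.Mod_generated[OF L LF] by (simp add: coxeter_group_def)
    also have "\<dots> \<subseteq> generate ?W (\<Union>s\<in>S. X s)"
    proof (rule W.generate_subgroup_incl[OF _ sub], clarify)
      fix s :: 'a and b :: bool assume s: "s \<in> S"
      let ?inv = "word_cong ?X ?R `` {[(s, False)]}"
      have gen: "?g s \<in> generate ?W (\<Union>s\<in>S. X s)"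
        using s by (auto simp: X_def intro!: generate.incl)
      show "?q (word_cong ?X ?R `` {[(s, b)]}) \<in> generate ?W (\<Union>s\<in>S. X s)"
      proof (cases b)
        case True
        then show ?thesis using gen by (simp add: g free_group_gen_def)
      next
        case False
        have inv: "?inv \<in> carrier ?F"
          using s by (auto simp: free_group_def word_quotient_def intro!: quotientI)
        have "([(s, False), (s, \<not> False)], []) \<in> ?R" using s unfolding free_group_rels_def by blast
        then have "([(s, False), (s, True)], []) \<in> word_cong ?X ?R"
          using word_cong.rel[of "[(s, False), (s, True)]" "[]" ?R "[]" "[]" ?X] s by simp
        then have "?inv \<otimes>\<^bsub>?F\<^esub> ?f s = \<one>\<^bsub>?F\<^esub>"
          using s equiv_class_eq[OF equiv_word_cong]
          by (simp add: free_group_gen_def free_group_def word_quotient_mult)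
            (simp add: word_quotient_def)
        then have "?inv = inv\<^bsub>?F\<^esub> (?f s)"
          using inv f[OF s] by (simp add: F.inv_equality)
        then have "?q ?inv = inv\<^bsub>?W\<^esub> (?g s)" using f[OF s] by (simp add: g)
        then show ?thesis using False subgroup.m_inv_closed[OF sub gen] by simp
      qed
    qed
    finally show "carrier ?W \<subseteq> generate ?W (\<Union>s\<in>S. X s)" .
  qed
  then interpret walled_group ?W S X h .
  have "coxeter_parabolic S M R \<longleftrightarrow> parabolic_subgroup ?W S X R" for R
    unfolding coxeter_parabolic_def parabolic_subgroup_def using gen_X by (metis (no_types, lifting))
  then show ?thesis using parabolic_subgroup_Int P Q by simp
qed

section \<open>Graph products\<close>

text \<open>
  Here the subgroups are the vertex groups themselves. The records of letters respect the
  multiplication of each vertex group by \<open>crossing_mult_same\<close> and the commutation relations along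
  the edges by \<open>crossing_commute\<close>.
\<close>

theorem graph_product_parabolic_Int:
  assumes G: "\<And>s. s \<in> S \<Longrightarrow> group (G s)"
    and P: "graph_product_parabolic S E G P" and Q: "graph_product_parabolic S E G Q"
  shows "graph_product_parabolic S E G (P \<inter> Q)"
proof -
  let ?F = "free_product S G" and ?W = "graph_product S E G" and ?N = "graph_product_kernel S E G"
  let ?L = "SIGMA s:S. carrier (G s)" and ?R = "free_product_rels S G"
  let ?C = "crossing_group ?W" and ?f = "free_product_inj S G" and ?X = "vertex_group S E G"
  interpret F: group ?F using G by (rule group_free_product)
  interpret W: group ?W using G by (rule group_graph_product)
  interpret C: group ?C by (rule W.group_crossing_group)
  have f: "?f s x \<in> carrier ?F" if "s \<in> S" "x \<in> carrier (G s)" for s x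
    using that by (rule free_product_inj_closed)
  have comms: "graph_product_commutators S E G \<subseteq> carrier ?F"
    using f by (auto simp: graph_product_commutators_def)
  interpret N: normal ?N ?F
    unfolding graph_product_kernel_def using comms by (rule F.normal_normal_closure)
  let ?q = "\<lambda>x. ?N #>\<^bsub>?F\<^esub> x"
  interpret q: group_hom ?F ?W ?q
    using N.r_coset_hom_Mod by unfold_locales (simp add: graph_product_def)
  have X: "?X s = (\<lambda>x. ?q (?f s x)) ` carrier (G s)" for s by (simp add: vertex_group_def)
  have f_mult: "?f s x \<otimes>\<^bsub>?F\<^esub> ?f s y = ?f s (x \<otimes>\<^bsub>G s\<^esub> y)"
    if s: "s \<in> S" and x: "x \<in> carrier (G s)" and y: "y \<in> carrier (G s)" for s x y
  proof -
    have "([(s, x), (s, y)], [(s, x \<otimes>\<^bsub>G s\<^esub> y)]) \<in> ?R"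
      using that unfolding free_product_rels_def by blast
    then have "([(s, x), (s, y)], [(s, x \<otimes>\<^bsub>G s\<^esub> y)]) \<in> word_cong ?L ?R"
      using word_cong.rel[of "[(s, x), (s, y)]" "[(s, x \<otimes>\<^bsub>G s\<^esub> y)]" ?R "[]" "[]" ?L] that
        monoid.m_closed[OF group.is_monoid[OF G[OF s]] x y] by simp
    then show ?thesis
      using that equiv_class_eq[OF equiv_word_cong]
      by (simp add: free_product_inj_def free_product_def word_quotient_mult)
  qed
  have qf_hom: "group_hom (G s) ?W (\<lambda>x. ?q (?f s x))" if "s \<in> S" for s
    using that G f f_mult
    by (auto simp: group_hom_def group_hom_axioms_def W.is_group hom_def simp flip: q.hom_mult)
  have subX: "subgroup (?X s) ?W" if "s \<in> S" for s
    unfolding X using qf_hom[OF that] by (rule group_hom.img_is_subgroup)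
  have qfX: "?q (?f s x) \<in> ?X s" if "x \<in> carrier (G s)" for s x using that by (auto simp: X)
  have XW: "?X s \<subseteq> carrier ?W" if "s \<in> S" for s using subgroup.subset[OF subX[OF that]] .
  have XE: "\<exists>y\<in>carrier (G s). x = ?q (?f s y)" if "x \<in> ?X s" for x s using that by (auto simp: X)
  have comm: "x \<otimes>\<^bsub>?W\<^esub> y = y \<otimes>\<^bsub>?W\<^esub> x" if st: "s \<in> S" "t \<in> S" "E s t" and x: "x \<in> ?X s" and y: "y \<in> ?X t"
    for s t x y
  proof -
    obtain a where a: "a \<in> carrier (G s)" "x = ?q (?f s a)" using XE[OF x] by blast
    obtain b where b: "b \<in> carrier (G t)" "y = ?q (?f t b)" using XE[OF y] by blast
    let ?c = "?f s a \<otimes>\<^bsub>?F\<^esub> ?f t b \<otimes>\<^bsub>?F\<^esub> inv\<^bsub>?F\<^esub> ?f s a \<otimes>\<^bsub>?F\<^esub> inv\<^bsub>?F\<^esub> ?f t b"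
    have "?c \<in> graph_product_commutators S E G"
      using st a b unfolding graph_product_commutators_def by blast
    also have "\<dots> \<subseteq> ?N" by (auto simp: graph_product_kernel_def normal_closure_def)
    finally have "?q ?c = \<one>\<^bsub>?W\<^esub>"
      by (simp add: graph_product_def FactGroup_def F.coset_join2 N.is_subgroup N.mem_carrier)
    then have "x \<otimes>\<^bsub>?W\<^esub> y \<otimes>\<^bsub>?W\<^esub> inv\<^bsub>?W\<^esub> x \<otimes>\<^bsub>?W\<^esub> inv\<^bsub>?W\<^esub> y = \<one>\<^bsub>?W\<^esub>"
      using f st a b by simp
    moreover have "x \<in> carrier ?W" "y \<in> carrier ?W" using x y XW st by auto
    ultimately show ?thesis
      by (metis W.inv_closed W.inv_equality W.inv_inv W.m_closed W.inv_solve_right')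
  qed
  define \<phi> where "\<phi> l = crossing ?W (?X (fst l)) (?q (?f (fst l) (snd l)))" for l
  have \<phi>: "\<phi> ` ?L \<subseteq> carrier ?C"
    using f by (auto simp: \<phi>_def W.crossing_closed)
  have "word_prod ?C \<phi> l = word_prod ?C \<phi> r" if "(l, r) \<in> ?R" for l r
    using that unfolding free_product_rels_def
  proof
    assume "(l, r) \<in> {([(s, \<one>\<^bsub>G s\<^esub>)], []) | s. s \<in> S}"
    then obtain s where s: "s \<in> S" "l = [(s, \<one>\<^bsub>G s\<^esub>)]" "r = []" by blast
    have "?q (?f s \<one>\<^bsub>G s\<^esub>) = \<one>\<^bsub>?W\<^esub>" using group_hom.hom_one[OF qf_hom[OF s(1)]] .
    then show ?thesis using s W.crossing_of_one by (simp add: \<phi>_def)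
  next
    assume "(l, r) \<in> {([(s, g), (s, h)], [(s, g \<otimes>\<^bsub>G s\<^esub> h)]) | s g h.
        s \<in> S \<and> g \<in> carrier (G s) \<and> h \<in> carrier (G s)}"
    then obtain s x y where s: "s \<in> S" "l = [(s, x), (s, y)]" "r = [(s, x \<otimes>\<^bsub>G s\<^esub> y)]"
      and xy: "x \<in> carrier (G s)" "y \<in> carrier (G s)" by blast
    have "\<phi> (s, x) \<otimes>\<^bsub>?C\<^esub> \<phi> (s, y) = \<phi> (s, x \<otimes>\<^bsub>G s\<^esub> y)"
      using W.crossing_mult_same[OF subX[OF s(1)] qfX[OF xy(1)] qfX[OF xy(2)]]
        group_hom.hom_mult[OF qf_hom[OF s(1)] xy] by (simp add: \<phi>_def)
    moreover have closed: "\<phi> (s, x) \<in> carrier ?C" "\<phi> (s, y) \<in> carrier ?C"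
      using \<phi> s(1) xy by auto
    ultimately show ?thesis
      using s C.m_closed[OF closed] by simp
  qed
  then obtain h0 where h0: "h0 \<in> hom ?F ?C"
    and h0_word: "\<And>u. u \<in> lists ?L \<Longrightarrow> h0 (word_cong ?L ?R `` {u}) = word_prod ?C \<phi> u"
    using word_quotient_lift[OF C.is_group \<phi>, of ?R] unfolding free_product_def by blast
  interpret h0: group_hom ?F ?C h0
    using h0 by unfold_locales
  have h0_inj: "h0 (?f s x) = crossing ?W (?X s) (?q (?f s x))"
    if "s \<in> S" "x \<in> carrier (G s)" for s x
    using that f by (simp add: free_product_inj_def[of S G s x] h0_word)
      (simp add: \<phi>_def W.crossing_closed flip: free_product_inj_def)
  have "h0 c = \<one>\<^bsub>?C\<^esub>" if comm_c: "c \<in> graph_product_commutators S E G" for c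
  proof -
    obtain s t a b where c: "c = ?f s a \<otimes>\<^bsub>?F\<^esub> ?f t b \<otimes>\<^bsub>?F\<^esub> inv\<^bsub>?F\<^esub> ?f s a \<otimes>\<^bsub>?F\<^esub> inv\<^bsub>?F\<^esub> ?f t b"
      and st: "s \<in> S" "t \<in> S" "E s t" and ab: "a \<in> carrier (G s)" "b \<in> carrier (G t)"
      using comm_c unfolding graph_product_commutators_def by blast
    let ?a = "h0 (?f s a)" and ?b = "h0 (?f t b)"
    have "?a \<otimes>\<^bsub>?C\<^esub> ?b = ?b \<otimes>\<^bsub>?C\<^esub> ?a"
      unfolding h0_inj[OF st(1) ab(1)] h0_inj[OF st(2) ab(2)]
      by (rule W.crossing_commute[OF subX[OF st(1)] subX[OF st(2)] qfX[OF ab(1)] qfX[OF ab(2)]])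
        (rule comm[OF st])
    moreover have "?a \<in> carrier ?C" "?b \<in> carrier ?C" using f st ab by auto
    ultimately show ?thesis
      using f st ab by (simp add: c C.m_assoc)
  qed
  then obtain h where h: "h \<in> hom ?W ?C" and h_q: "\<And>x. x \<in> carrier ?F \<Longrightarrow> h (?q x) = h0 x"
    using F.Mod_normal_closure_lift[OF comms C.is_group h0]
    unfolding graph_product_def graph_product_kernel_def by blast
  have "walled_group ?W S ?X h"
  proof (intro walled_group.intro walled_group_axioms.intro W.is_group subX h)
    show "h x = crossing ?W (?X s) x" if "s \<in> S" "x \<in> ?X s" for s x
      using that XE[of x s] h0_inj f h_q by auto
    let ?Y = "(\<lambda>x. word_cong ?L ?R `` {[x]}) ` ?L"
    have Y: "carrier ?F \<subseteq> generate ?F ?Y"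
      unfolding free_product_def by (rule word_quotient_generated)
    have YF: "?Y \<subseteq> carrier ?F"
      by (auto simp: free_product_def word_quotient_def intro!: quotientI)
    have "carrier ?W \<subseteq> generate ?W (?q ` ?Y)"
      using N.Mod_generated[OF Y YF] by (simp add: graph_product_def)
    also have "\<dots> \<subseteq> generate ?W (\<Union>s\<in>S. ?X s)"
      using qfX by (intro W.mono_generate) (auto simp: free_product_inj_def)
    finally show "carrier ?W \<subseteq> generate ?W (\<Union>s\<in>S. ?X s)" .
  qed
  then interpret walled_group ?W S ?X h .
  show ?thesis using parabolic_subgroup_Int P Q by (simp add: graph_product_parabolic_def)
qed

theorem corollary1p2:
  fixes S :: "'a set" and M :: "'a \<Rightarrow> 'a \<Rightarrow> enat"
    and V :: "'b set" and E :: "'b \<Rightarrow> 'b \<Rightarrow> bool" and G :: "'b \<Rightarrow> ('c, 'm) monoid_scheme"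
  shows "(coxeter_matrix S M \<longrightarrow>
            (\<forall>P Q. coxeter_parabolic S M P \<longrightarrow> coxeter_parabolic S M Q \<longrightarrow>
                   coxeter_parabolic S M (P \<inter> Q))) \<and>
         (simplicial_graph V E \<longrightarrow> (\<forall>s\<in>V. group (G s)) \<longrightarrow>
            (\<forall>P Q. graph_product_parabolic V E G P \<longrightarrow> graph_product_parabolic V E G Q \<longrightarrow>
                   graph_product_parabolic V E G (P \<inter> Q)))"
proof (intro conjI impI allI)
  show "coxeter_parabolic S M (P \<inter> Q)"
    if "coxeter_matrix S M" "coxeter_parabolic S M P" "coxeter_parabolic S M Q" for P Q
    using that by (rule coxeter_parabolic_Int)
  show "graph_product_parabolic V E G (P \<inter> Q)"
    if "\<forall>s\<in>V. group (G s)" "graph_product_parabolic V E G P" "graph_product_parabolic V E G Q"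
    for P Q
    by (rule graph_product_parabolic_Int[OF bspec[OF that(1)] that(2,3)])
qed

end
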